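(* Let $f:(0,\infty)\to(0,\infty)$ be operator monotone, extended by $f(0)=0$. Let $\phi:\mathbb{M}_n\to\mathbb{M}_m$ be a linear map satisfying the Schwarz inequality $\phi(K^*K)\geq\phi(K)^*\phi(K)$ for all $K\in\mathbb{M}_n$ (no unitality assumed), with Hilbert–Schmidt adjoint $\phi^*$. Then for all positive definite $X,Y\in\mathbb{M}_m$: (a) $\phi\,\mathbb{J}_f(\phi^*(X),\phi^*(Y))^{+}\,\phi^*\leq\mathbb{J}_f(X,Y)^{-1}$ as operators on $\mathcal{H}_m$; (b) $\phi^*\,\mathbb{J}_f(X,Y)\,\phi\leq\mathbb{J}_f(\phi^*(X),\phi^*(Y))$ as operators on $\mathcal{H}_n$.
   Context: $\mathcal{H}_k$ denotes $\mathbb{M}_k$ (complex $k\times k$ matrices) with the Hilbert–Schmidt inner product $\langle A,B\rangle=\mathrm{Tr}[A^*B]$; $\phi:\mathcal{H}_n\to\mathcal{H}_m$ and $\phi^*:\mathcal{H}_m\to\mathcal{H}_n$ is its adjoint. For $X\in\mathbb{M}_k$, $L_X(A)=XA$ and $R_X(A)=AX$ are operators on $\mathcal{H}_k$; for positive semidefinite $X,Y$ they are commuting positive semidefinite operators. For positive semidefinite $X,Y\in\mathbb{M}_k$ define the positive semidefinite operator $\mathbb{J}_f(X,Y):=f(R_XL_Y^{+})L_Y$ on $\mathcal{H}_k$, where $L_Y^+$ is the Moore–Penrose generalized inverse of $L_Y$ and $f$ is applied via functional calculus (with $f(0)=0$). $T^+$ denotes the Moore–Penrose inverse of an operator $T$,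 and $\leq$ is the Loewner order. *)

theory Defs
  imports "Jordan_Normal_Form.Schur_Decomposition"
begin

(* Matrices in M_k are complex mat of carrier_mat k k; operators on H_k are
   maps complex mat => complex mat, considered on carrier_mat k k only. *)

definition mtrace :: "complex mat \<Rightarrow> complex" where
  "mtrace A = (\<Sum>i<dim_row A. A $$ (i,i))"

definition hs_inner :: "complex mat \<Rightarrow> complex mat \<Rightarrow> complex" where
  "hs_inner A B = mtrace (mat_adjoint A * B)"

definition psd_mat :: "nat \<Rightarrow> complex mat \<Rightarrow> bool" where
  "psd_mat k X \<longleftrightarrow> X \<in> carrier_mat k k \<and> (\<forall>v\<in>carrier_vec k. (X *\<^sub>v v) \<bullet>c v \<ge> 0)"

definition pd_mat :: "nat \<Rightarrow> complex mat \<Rightarrow> bool" where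
  "pd_mat k X \<longleftrightarrow> X \<in> carrier_mat k k \<and>
     (\<forall>v\<in>carrier_vec k. v \<noteq> 0\<^sub>v k \<longrightarrow> (X *\<^sub>v v) \<bullet>c v > 0)"

definition mat_le :: "nat \<Rightarrow> complex mat \<Rightarrow> complex mat \<Rightarrow> bool" where
  "mat_le k A B \<longleftrightarrow> A \<in> carrier_mat k k \<and> B \<in> carrier_mat k k \<and> psd_mat k (B - A)"

(* functional calculus of a (Hermitian, hence diagonalizable) matrix:
   f(X) acts as f(lambda) on each eigenvector with eigenvalue lambda *)
definition mat_fun :: "nat \<Rightarrow> (real \<Rightarrow> real) \<Rightarrow> complex mat \<Rightarrow> complex mat" where
  "mat_fun k f X = (SOME B. B \<in> carrier_mat k k \<and>
     (\<forall>c v. eigenvector X v c \<longrightarrow> B *\<^sub>v v = complex_of_real (f (Re c)) \<cdot>\<^sub>v v))"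

definition op_monotone :: "(real \<Rightarrow> real) \<Rightarrow> bool" where
  "op_monotone f \<longleftrightarrow> (\<forall>k A B. pd_mat k A \<and> pd_mat k B \<and> mat_le k A B \<longrightarrow>
       mat_le k (mat_fun k f A) (mat_fun k f B))"

definition lin_map :: "nat \<Rightarrow> nat \<Rightarrow> (complex mat \<Rightarrow> complex mat) \<Rightarrow> bool" where
  "lin_map n m \<phi> \<longleftrightarrow> (\<forall>A\<in>carrier_mat n n. \<phi> A \<in> carrier_mat m m) \<and>
     (\<forall>A\<in>carrier_mat n n. \<forall>B\<in>carrier_mat n n. \<phi> (A + B) = \<phi> A + \<phi> B) \<and>
     (\<forall>c. \<forall>A\<in>carrier_mat n n. \<phi> (c \<cdot>\<^sub>m A) = c \<cdot>\<^sub>m \<phi> A)"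

definition hs_adjoint :: "nat \<Rightarrow> nat \<Rightarrow> (complex mat \<Rightarrow> complex mat) \<Rightarrow> (complex mat \<Rightarrow> complex mat) \<Rightarrow> bool" where
  "hs_adjoint n m \<phi> \<psi> \<longleftrightarrow> (\<forall>B\<in>carrier_mat m m. \<psi> B \<in> carrier_mat n n) \<and>
     (\<forall>A\<in>carrier_mat n n. \<forall>B\<in>carrier_mat m m. hs_inner (\<phi> A) B = hs_inner A (\<psi> B))"

definition op_sa :: "nat \<Rightarrow> (complex mat \<Rightarrow> complex mat) \<Rightarrow> bool" where
  "op_sa k T \<longleftrightarrow> (\<forall>A\<in>carrier_mat k k. \<forall>B\<in>carrier_mat k k. hs_inner (T A) B = hs_inner A (T B))"

definition op_psd :: "nat \<Rightarrow> (complex mat \<Rightarrow> complex mat) \<Rightarrow> bool" where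
  "op_psd k T \<longleftrightarrow> (\<forall>A\<in>carrier_mat k k. hs_inner A (T A) \<ge> 0)"

definition op_le :: "nat \<Rightarrow> (complex mat \<Rightarrow> complex mat) \<Rightarrow> (complex mat \<Rightarrow> complex mat) \<Rightarrow> bool" where
  "op_le k S T \<longleftrightarrow> op_psd k (\<lambda>A. T A - S A)"

definition op_mp :: "nat \<Rightarrow> (complex mat \<Rightarrow> complex mat) \<Rightarrow> (complex mat \<Rightarrow> complex mat)" where
  "op_mp k T = (SOME S. lin_map k k S \<and>
     (\<forall>A\<in>carrier_mat k k. T (S (T A)) = T A \<and> S (T (S A)) = S A) \<and>
     op_sa k (T \<circ> S) \<and> op_sa k (S \<circ> T))"

definition op_inv :: "nat \<Rightarrow> (complex mat \<Rightarrow> complex mat) \<Rightarrow> (complex mat \<Rightarrow> complex mat)" where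
  "op_inv k T = (SOME S. lin_map k k S \<and> (\<forall>A\<in>carrier_mat k k. S (T A) = A \<and> T (S A) = A))"

(* functional calculus of a diagonalizable (here: positive semidefinite) operator on H_k *)
definition op_fun :: "nat \<Rightarrow> (real \<Rightarrow> real) \<Rightarrow> (complex mat \<Rightarrow> complex mat) \<Rightarrow> (complex mat \<Rightarrow> complex mat)" where
  "op_fun k f T = (SOME S. lin_map k k S \<and>
     (\<forall>c A. A \<in> carrier_mat k k \<and> A \<noteq> 0\<^sub>m k k \<and> T A = c \<cdot>\<^sub>m A \<longrightarrow>
        S A = complex_of_real (f (Re c)) \<cdot>\<^sub>m A))"

definition lmul :: "complex mat \<Rightarrow> complex mat \<Rightarrow> complex mat" where
  "lmul X = (\<lambda>A. X * A)"

definition rmul :: "complex mat \<Rightarrow> complex mat \<Rightarrow> complex mat" where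
  "rmul X = (\<lambda>A. A * X)"

definition Jf :: "nat \<Rightarrow> (real \<Rightarrow> real) \<Rightarrow> complex mat \<Rightarrow> complex mat \<Rightarrow> (complex mat \<Rightarrow> complex mat)" where
  "Jf k f X Y = op_fun k f (rmul X \<circ> op_mp k (lmul Y)) \<circ> lmul Y"

end

theory Submission
  imports Defs "Jordan_Normal_Form.Spectral_Radius"
begin

text \<open>
  Diagonalise \<open>Y = U diag(\<mu>) U\<^sup>*\<close> and \<open>X = V diag(\<kappa>) V\<^sup>*\<close>. In the orthonormal basis of rank-one
  matrices \<open>u\<^sub>i v\<^sub>j\<^sup>*\<close> the operators \<open>L\<^sub>Y\<close> and \<open>R\<^sub>X\<close> are diagonal, and \<open>J\<^sub>f(X,Y)\<close> has the
  eigenvalues \<open>f(\<kappa>\<^sub>j / \<mu>\<^sub>i) \<mu>\<^sub>i\<close>; similarly for \<open>\<phi>\<^sup>*(X)\<close> and \<open>\<phi>\<^sup>*(Y)\<close>. The Schwarz inequality,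
  paired with \<open>X\<close> and \<open>Y\<close> under the trace, says that \<open>\<phi>\<^sup>* R\<^sub>X \<phi>\<close> and \<open>\<phi>\<^sup>* L\<^sub>Y \<phi>\<close> are dominated by
  the right and left multiplications by \<open>\<phi>\<^sup>*(X)\<close> and \<open>\<phi>\<^sup>*(Y)\<close>. Rescaled by the square roots of
  \<open>L\<^sub>Y\<close> and of its counterpart, the matrix of \<open>\<phi>\<close> becomes a contraction \<open>W\<close> with \<open>W\<^sup>* A W \<le> B\<close>,
  and (b) becomes Hansen's inequality \<open>W\<^sup>* f(A) W \<le> f(B)\<close>. The latter follows from operator
  monotonicity by completing \<open>W\<close> to an isometry \<open>Z\<close> and comparing \<open>A\<close> with an operator that is
  almost \<open>B\<close> on the range of \<open>Z\<close> and a large constant on its complement. Part (a) follows from (b)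
  by completing the square.
\<close>

section \<open>Adjoints and quadratic forms\<close>

lemma mat_adjoint_dim [simp]:
  "dim_row (mat_adjoint A) = dim_col A" "dim_col (mat_adjoint A) = dim_row A"
  unfolding mat_adjoint_def by (auto simp: mat_of_rows_def)

lemma mat_adjoint_carrier [simp]: "mat_adjoint A \<in> carrier_mat m n \<longleftrightarrow> A \<in> carrier_mat n m"
  unfolding carrier_mat_def by auto

lemma mat_adjoint_index [simp]:
  "i < dim_col A \<Longrightarrow> j < dim_row A \<Longrightarrow> mat_adjoint A $$ (i, j) = conjugate (A $$ (j, i))"
  unfolding mat_adjoint_def by (auto simp: mat_of_rows_def)

lemma mat_adjoint_adjoint [simp]: "mat_adjoint (mat_adjoint A) = A"
  by (rule eq_matI) auto

lemma mat_adjoint_mult: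
  assumes "A \<in> carrier_mat n m" "B \<in> carrier_mat m k"
  shows "mat_adjoint (A * B) = mat_adjoint B * mat_adjoint A"
  by (rule eq_matI)
    (use assms in \<open>auto simp: scalar_prod_def sum_conjugate conjugate_dist_mul mult.commute\<close>)

lemma mat_adjoint_add:
  assumes "A \<in> carrier_mat n m" "B \<in> carrier_mat n m"
  shows "mat_adjoint (A + B) = mat_adjoint A + mat_adjoint B"
  by (rule eq_matI) (use assms in \<open>auto simp: conjugate_dist_add\<close>)

lemma mat_adjoint_minus:
  fixes A B :: "complex mat"
  assumes "A \<in> carrier_mat n m" "B \<in> carrier_mat n m"
  shows "mat_adjoint (A - B) = mat_adjoint A - mat_adjoint B"
  by (rule eq_matI) (use assms in auto)

lemma mat_adjoint_smult: "mat_adjoint (c \<cdot>\<^sub>m A) = conjugate c \<cdot>\<^sub>m mat_adjoint A"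
  by (rule eq_matI) (auto simp: conjugate_dist_mul)

lemma mat_adjoint_one [simp]: "mat_adjoint (1\<^sub>m n :: complex mat) = 1\<^sub>m n"
  by (rule eq_matI) auto

lemma mat_adjoint_four_block_diag:
  fixes A B :: "complex mat"
  assumes "A \<in> carrier_mat n n" "B \<in> carrier_mat m m"
  shows "mat_adjoint (four_block_mat A (0\<^sub>m n m) (0\<^sub>m m n) B)
    = four_block_mat (mat_adjoint A) (0\<^sub>m n m) (0\<^sub>m m n) (mat_adjoint B)"
  by (rule eq_matI) (use assms in auto)

lemma mult_four_block_diag:
  fixes A B C D :: "'a::semiring_1 mat"
  assumes "A \<in> carrier_mat n n" "B \<in> carrier_mat m m" "C \<in> carrier_mat n n" "D \<in> carrier_mat m m"
  shows "four_block_mat A (0\<^sub>m n m) (0\<^sub>m m n) B * four_block_mat C (0\<^sub>m n m) (0\<^sub>m m n) D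
    = four_block_mat (A * C) (0\<^sub>m n m) (0\<^sub>m m n) (B * D)"
  by (subst mult_four_block_mat[OF assms(1) _ _ assms(2,3) _ _ assms(4)]) (use assms in auto)

lemma append_rows_congruence:
  fixes W N A B :: "complex mat"
  assumes W: "W \<in> carrier_mat p q" and N: "N \<in> carrier_mat r q"
    and A: "A \<in> carrier_mat p p" and B: "B \<in> carrier_mat r r"
  shows "mat_adjoint (W @\<^sub>r N) * four_block_mat A (0\<^sub>m p r) (0\<^sub>m r p) B * (W @\<^sub>r N)
    = mat_adjoint W * A * W + mat_adjoint N * B * N"
proof -
  have W': "mat_adjoint W \<in> carrier_mat q p" and N': "mat_adjoint N \<in> carrier_mat q r"
    using W N by auto
  have adjoint_append:
    "mat_adjoint (W @\<^sub>r N) = four_block_mat (mat_adjoint W) (mat_adjoint N) (0\<^sub>m 0 p) (0\<^sub>m 0 r)"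
    by (rule eq_matI) (use W N in \<open>auto simp: append_rows_def\<close>)
  have "mat_adjoint (W @\<^sub>r N) * four_block_mat A (0\<^sub>m p r) (0\<^sub>m r p) B
      = four_block_mat (mat_adjoint W * A) (mat_adjoint N * B) (0\<^sub>m 0 p) (0\<^sub>m 0 r)"
    unfolding adjoint_append using W' N' A B
    by (subst mult_four_block_mat[of _ q p _ r _ 0 _ _ p _ r]) (auto intro!: cong_four_block_mat)
  also have "\<dots> * (W @\<^sub>r N)
      = four_block_mat (mat_adjoint W * A * W + mat_adjoint N * B * N) (0\<^sub>m q 0) (0\<^sub>m 0 q) (0\<^sub>m 0 0)"
    unfolding append_rows_def using W N W' N' A B
    by (subst mult_four_block_mat[of _ q p _ r _ 0 _ _ q _ 0]) (auto intro!: cong_four_block_mat)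
  also have "\<dots> = mat_adjoint W * A * W + mat_adjoint N * B * N"
    by (rule eq_matI) (use N in auto)
  finally show ?thesis .
qed

lemma append_rows_congruence_smult_one:
  fixes W N A :: "complex mat"
  assumes W: "W \<in> carrier_mat p q" and N: "N \<in> carrier_mat r q" and A: "A \<in> carrier_mat p p"
  shows "mat_adjoint (W @\<^sub>r N) * four_block_mat A (0\<^sub>m p r) (0\<^sub>m r p) (c \<cdot>\<^sub>m 1\<^sub>m r) * (W @\<^sub>r N)
    = mat_adjoint W * A * W + c \<cdot>\<^sub>m (mat_adjoint N * N)"
  using append_rows_congruence[OF W N A, of "c \<cdot>\<^sub>m 1\<^sub>m r"] N
  by (simp add: mult_smult_distrib[of _ q r _ r] mult_smult_assoc_mat[of _ q r _ q])

lemma congruence_carrier: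
  "A \<in> carrier_mat n n \<Longrightarrow> Z \<in> carrier_mat n m \<Longrightarrow> mat_adjoint Z * A * Z \<in> carrier_mat m m"
  by (intro mult_carrier_mat[of _ m n _ m] mult_carrier_mat[of _ m n _ n]) auto

lemma congruence_mult:
  fixes A V R :: "complex mat"
  assumes "A \<in> carrier_mat p p" "V \<in> carrier_mat p q" "R \<in> carrier_mat q r"
  shows "mat_adjoint (V * R) * A * (V * R) = mat_adjoint R * (mat_adjoint V * A * V) * R"
proof -
  note V = assms(2) and R = assms(3)
  have adjoints: "mat_adjoint V \<in> carrier_mat q p" "mat_adjoint R \<in> carrier_mat r q"
    and VA: "mat_adjoint V * A \<in> carrier_mat q p"
    using assms by (auto intro!: mult_carrier_mat[of _ q p])
  have "mat_adjoint (V * R) * A * (V * R) = mat_adjoint R * (mat_adjoint V * A) * (V * R)"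
    unfolding mat_adjoint_mult[OF V R] using assms(1) adjoints
    by (simp add: assoc_mult_mat[of _ r q _ p _ p])
  also have "\<dots> = mat_adjoint R * (mat_adjoint V * A * (V * R))"
    using V R VA adjoints by (intro assoc_mult_mat[of _ r q _ p _ r]) auto
  also have "mat_adjoint V * A * (V * R) = mat_adjoint V * A * V * R"
    using V R VA by (intro assoc_mult_mat[symmetric, of _ q p _ q _ r]) auto
  also have "mat_adjoint R * (mat_adjoint V * A * V * R) = mat_adjoint R * (mat_adjoint V * A * V) * R"
    using V R VA adjoints by (intro assoc_mult_mat[symmetric, of _ r q _ q _ r]) auto
  finally show ?thesis .
qed

lemma cscalar_prod_mat_adjoint:
  assumes "A \<in> carrier_mat n m" "v \<in> carrier_vec m" "w \<in> carrier_vec n"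
  shows "(A *\<^sub>v v) \<bullet>c w = v \<bullet>c (mat_adjoint A *\<^sub>v w)"
proof -
  have "conjugate (mat_adjoint A *\<^sub>v w) = transpose_mat A *\<^sub>v conjugate w"
    by (rule eq_vecI)
      (use assms in \<open>auto simp: scalar_prod_def sum_conjugate conjugate_dist_mul\<close>)
  then have "v \<bullet>c (mat_adjoint A *\<^sub>v w) = (transpose_mat A *\<^sub>v conjugate w) \<bullet> v"
    using assms by (simp add: comm_scalar_prod[of _ m])
  also have "\<dots> = conjugate w \<bullet> (A *\<^sub>v v)"
    using assms by (intro transpose_vec_mult_scalar) auto
  also have "\<dots> = (A *\<^sub>v v) \<bullet>c w"
    using assms by (intro comm_scalar_prod[of _ n]) auto
  finally show ?thesis ..
qed

lemma mult_mat_vec_unit_vec: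
  fixes A :: "'a::semiring_1 mat"
  assumes "A \<in> carrier_mat n m" "j < m"
  shows "A *\<^sub>v unit_vec m j = col A j"
  using assms by (intro eq_vecI) auto

lemma conjugate_unit_vec [simp]: "conjugate (unit_vec n i) = (unit_vec n i :: complex vec)"
  by (rule eq_vecI) (auto simp: unit_vec_def)

lemma cscalar_prod_mult_col:
  fixes A :: "complex mat"
  assumes "A \<in> carrier_mat n m" "P \<in> carrier_mat n p" "Q \<in> carrier_mat m q" "i < p" "j < q"
  shows "(mat_adjoint P * A * Q) $$ (i, j) = (A *\<^sub>v col Q j) \<bullet>c col P i"
proof -
  have "(mat_adjoint P * A * Q) $$ (i, j) = (mat_adjoint P * (A * Q)) $$ (i, j)"
    using assms by (simp add: assoc_mult_mat[of _ p n _ m _ q])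
  also have "\<dots> = (\<Sum>l<n. cnj (P $$ (l, i)) * (A *\<^sub>v col Q j) $ l)"
    using assms by (simp add: scalar_prod_def lessThan_atLeast0)
  also have "\<dots> = (A *\<^sub>v col Q j) \<bullet>c col P i"
    using assms by (simp add: scalar_prod_def lessThan_atLeast0 mult.commute)
  finally show ?thesis .
qed

lemma cscalar_prod_commute:
  fixes v w :: "complex vec"
  assumes "v \<in> carrier_vec n" "w \<in> carrier_vec n"
  shows "w \<bullet>c v = cnj (v \<bullet>c w)"
  using assms by (simp add: scalar_prod_def mult.commute)

lemma cscalar_prod_self:
  fixes v :: "complex vec"
  assumes "v \<in> carrier_vec n"
  shows "v \<bullet>c v = complex_of_real (\<Sum>i<n. (cmod (v $ i))\<^sup>2)"
  using assms unfolding scalar_prod_def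
  by (auto simp: lessThan_atLeast0 complex_norm_square simp del: of_real_power intro!: sum.cong)

lemma cscalar_prod_mat_add_smult:
  fixes A :: "complex mat"
  assumes "A \<in> carrier_mat n n" "u \<in> carrier_vec n" "v \<in> carrier_vec n"
  shows "(A *\<^sub>v (u + z \<cdot>\<^sub>v v)) \<bullet>c (u + z \<cdot>\<^sub>v v) = (A *\<^sub>v u) \<bullet>c u
    + cnj z * ((A *\<^sub>v u) \<bullet>c v) + z * ((A *\<^sub>v v) \<bullet>c u) + z * cnj z * ((A *\<^sub>v v) \<bullet>c v)"
proof -
  have Au: "A *\<^sub>v u \<in> carrier_vec n" and Av: "A *\<^sub>v v \<in> carrier_vec n"
    using assms by auto
  have "A *\<^sub>v (u + z \<cdot>\<^sub>v v) = A *\<^sub>v u + z \<cdot>\<^sub>v (A *\<^sub>v v)"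
    using assms by (simp add: mult_add_distrib_mat_vec[of _ n n] mult_mat_vec[of _ n n])
  then show ?thesis
    using assms Au Av
    by (simp add: conjugate_add_vec[of _ n] conjugate_smult_vec add_scalar_prod_distrib[of _ n]
        scalar_prod_add_distrib[of _ n] algebra_simps)
qed

lemma mat_eq_if_cscalar_prod_eq:
  fixes A B :: "complex mat"
  assumes A: "A \<in> carrier_mat n n" and B: "B \<in> carrier_mat n n"
    and form_eq: "\<And>v. v \<in> carrier_vec n \<Longrightarrow> (A *\<^sub>v v) \<bullet>c v = (B *\<^sub>v v) \<bullet>c v"
  shows "A = B"
proof (rule eq_matI)
  have sesquilinear_eq: "(A *\<^sub>v u) \<bullet>c v = (B *\<^sub>v u) \<bullet>c v"
    if "u \<in> carrier_vec n" "v \<in> carrier_vec n" for u v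
  proof -
    have "cnj z * ((A *\<^sub>v u) \<bullet>c v) + z * ((A *\<^sub>v v) \<bullet>c u)
        = cnj z * ((B *\<^sub>v u) \<bullet>c v) + z * ((B *\<^sub>v v) \<bullet>c u)" for z
      using form_eq[of "u + z \<cdot>\<^sub>v v"] that form_eq[OF that(1)] form_eq[OF that(2)]
      by (simp add: cscalar_prod_mat_add_smult[OF A] cscalar_prod_mat_add_smult[OF B])
    from this[of 1] this[of \<i>] show ?thesis
      by (simp add: complex_eq_iff)
  qed
  fix i j assume "i < dim_row B" "j < dim_col B"
  then have ij: "i < n" "j < n" using B by auto
  have "(C *\<^sub>v unit_vec n j) \<bullet>c unit_vec n i = C $$ (i, j)"
    if "C \<in> carrier_mat n n" for C :: "complex mat"
    using that ij by (simp add: mult_mat_vec_unit_vec)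
  then show "A $$ (i, j) = B $$ (i, j)"
    using sesquilinear_eq[of "unit_vec n j" "unit_vec n i"] A B by simp
qed (use A B in auto)

definition hermitian_mat :: "nat \<Rightarrow> complex mat \<Rightarrow> bool" where
  "hermitian_mat k A \<longleftrightarrow> A \<in> carrier_mat k k \<and> mat_adjoint A = A"

definition qform :: "complex mat \<Rightarrow> complex vec \<Rightarrow> real" where
  "qform A v = Re ((A *\<^sub>v v) \<bullet>c v)"

lemma hermitian_matD:
  assumes "hermitian_mat k A"
  shows "A \<in> carrier_mat k k" "mat_adjoint A = A"
  using assms by (auto simp: hermitian_mat_def)

lemma hermitian_mat_one [simp]: "hermitian_mat k (1\<^sub>m k)"
  by (simp add: hermitian_mat_def)

lemma hermitian_mat_add: "hermitian_mat k A \<Longrightarrow> hermitian_mat k B \<Longrightarrow> hermitian_mat k (A + B)"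
  by (auto simp: hermitian_mat_def mat_adjoint_add[of _ k k])

lemma hermitian_mat_minus: "hermitian_mat k A \<Longrightarrow> hermitian_mat k B \<Longrightarrow> hermitian_mat k (A - B)"
  by (auto simp: hermitian_mat_def mat_adjoint_minus[of _ k k] intro: minus_carrier_mat)

lemma hermitian_mat_smult: "hermitian_mat k A \<Longrightarrow> hermitian_mat k (complex_of_real c \<cdot>\<^sub>m A)"
  by (auto simp: hermitian_mat_def mat_adjoint_smult)

lemma hermitian_mat_congruence:
  assumes "hermitian_mat n A" "Z \<in> carrier_mat n m"
  shows "hermitian_mat m (mat_adjoint Z * A * Z)"
  using assms
  by (auto simp: hermitian_mat_def mat_adjoint_mult[of _ m n _ m] mat_adjoint_mult[of _ n n _ m]
      assoc_mult_mat[of _ m n _ n _ m])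

lemma hermitian_mat_congruence_adjoint:
  assumes "hermitian_mat n A" "Z \<in> carrier_mat m n"
  shows "hermitian_mat m (Z * A * mat_adjoint Z)"
  using hermitian_mat_congruence[OF assms(1), of "mat_adjoint Z" m] assms(2) by auto

lemma qform_add:
  assumes "A \<in> carrier_mat k k" "B \<in> carrier_mat k k" "v \<in> carrier_vec k"
  shows "qform (A + B) v = qform A v + qform B v"
  using assms by (simp add: qform_def add_mult_distrib_mat_vec[of _ k k]
    add_scalar_prod_distrib[of _ k] mult_mat_vec_carrier[of _ k k])

lemma qform_minus:
  assumes "A \<in> carrier_mat k k" "B \<in> carrier_mat k k" "v \<in> carrier_vec k"
  shows "qform (A - B) v = qform A v - qform B v"
  using assms by (simp add: qform_def minus_mult_distrib_mat_vec[of _ k k]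
    minus_scalar_prod_distrib[of _ k] mult_mat_vec_carrier[of _ k k])

lemma qform_smult:
  assumes "A \<in> carrier_mat k k" "v \<in> carrier_vec k"
  shows "qform (complex_of_real c \<cdot>\<^sub>m A) v = c * qform A v"
proof -
  have "(complex_of_real c \<cdot>\<^sub>m A) *\<^sub>v v = complex_of_real c \<cdot>\<^sub>v (A *\<^sub>v v)"
    using assms by (intro eq_vecI) auto
  then show ?thesis using assms by (simp add: qform_def mult_mat_vec_carrier[of _ k k])
qed

lemma qform_congruence:
  assumes "A \<in> carrier_mat n n" "Z \<in> carrier_mat n m" "v \<in> carrier_vec m"
  shows "qform (mat_adjoint Z * A * Z) v = qform A (Z *\<^sub>v v)"
proof -
  have Zv: "Z *\<^sub>v v \<in> carrier_vec n" and AZv: "A *\<^sub>v (Z *\<^sub>v v) \<in> carrier_vec n"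
    using assms by auto
  have "(mat_adjoint Z * A * Z) *\<^sub>v v = (mat_adjoint Z * A) *\<^sub>v (Z *\<^sub>v v)"
    using assms by (intro assoc_mult_mat_vec[of _ m n _ m]) auto
  also have "\<dots> = mat_adjoint Z *\<^sub>v (A *\<^sub>v (Z *\<^sub>v v))"
    using assms Zv by (intro assoc_mult_mat_vec[of _ m n _ n]) auto
  finally have "(mat_adjoint Z * A * Z) *\<^sub>v v = mat_adjoint Z *\<^sub>v (A *\<^sub>v (Z *\<^sub>v v))" .
  then show ?thesis
    using cscalar_prod_mat_adjoint[of "mat_adjoint Z" m n "A *\<^sub>v (Z *\<^sub>v v)" v] assms AZv
    by (simp add: qform_def)
qed

lemma qform_congruence_adjoint:
  assumes "A \<in> carrier_mat n n" "Z \<in> carrier_mat m n" "v \<in> carrier_vec m"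
  shows "qform (Z * A * mat_adjoint Z) v = qform A (mat_adjoint Z *\<^sub>v v)"
  using qform_congruence[OF assms(1), of "mat_adjoint Z" m v] assms by auto

lemma hermitian_mat_cscalar_prod:
  assumes "hermitian_mat k A" "u \<in> carrier_vec k" "v \<in> carrier_vec k"
  shows "(A *\<^sub>v v) \<bullet>c u = cnj ((A *\<^sub>v u) \<bullet>c v)"
  using assms cscalar_prod_mat_adjoint[of A k k v u] cscalar_prod_commute[of "A *\<^sub>v u" k v]
  by (auto simp: hermitian_mat_def)

lemma hermitian_mat_qform:
  assumes "hermitian_mat k A" "v \<in> carrier_vec k"
  shows "(A *\<^sub>v v) \<bullet>c v = complex_of_real (qform A v)"
  using hermitian_mat_cscalar_prod[OF assms(1,2,2)] by (simp add: qform_def complex_eq_iff)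

lemma qform_add_smult:
  assumes A: "hermitian_mat k A" and v: "v \<in> carrier_vec k" and w: "w \<in> carrier_vec k"
  shows "qform A (v + complex_of_real t \<cdot>\<^sub>v w)
    = qform A v + 2 * t * Re ((A *\<^sub>v v) \<bullet>c w) + t\<^sup>2 * qform A w"
  using hermitian_mat_cscalar_prod[OF A v w]
  by (simp add: qform_def cscalar_prod_mat_add_smult[OF hermitian_matD(1)[OF A] v w]
      power2_eq_square)

lemma qform_one_nonneg: "v \<in> carrier_vec k \<Longrightarrow> 0 \<le> qform (1\<^sub>m k) v"
  by (simp add: qform_def cscalar_prod_self sum_nonneg)

section \<open>Positive semidefinite matrices and the Loewner order\<close>

lemma hermitian_mat_if_form_real:
  assumes A: "A \<in> carrier_mat k k" and real: "\<And>v. v \<in> carrier_vec k \<Longrightarrow> Im ((A *\<^sub>v v) \<bullet>c v) = 0"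
  shows "hermitian_mat k A"
proof -
  have "(mat_adjoint A *\<^sub>v v) \<bullet>c v = (A *\<^sub>v v) \<bullet>c v" if v: "v \<in> carrier_vec k" for v
  proof -
    have Av: "A *\<^sub>v v \<in> carrier_vec k" using A v by auto
    have "(mat_adjoint A *\<^sub>v v) \<bullet>c v = v \<bullet>c (A *\<^sub>v v)"
      using cscalar_prod_mat_adjoint[of "mat_adjoint A" k k v v] A v by auto
    also have "\<dots> = cnj ((A *\<^sub>v v) \<bullet>c v)" by (rule cscalar_prod_commute[OF Av v])
    finally show ?thesis using real[OF v] by (simp add: complex_eq_iff)
  qed
  then have "mat_adjoint A = A" using A by (intro mat_eq_if_cscalar_prod_eq) auto
  with A show ?thesis by (simp add: hermitian_mat_def)
qed

lemma psd_mat_iff_qform: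
  "psd_mat k A \<longleftrightarrow> hermitian_mat k A \<and> (\<forall>v\<in>carrier_vec k. 0 \<le> qform A v)"
proof
  assume psd: "psd_mat k A"
  then have "hermitian_mat k A"
    by (intro hermitian_mat_if_form_real) (auto simp: psd_mat_def less_eq_complex_def)
  with psd show "hermitian_mat k A \<and> (\<forall>v\<in>carrier_vec k. 0 \<le> qform A v)"
    by (auto simp: psd_mat_def qform_def less_eq_complex_def)
next
  assume "hermitian_mat k A \<and> (\<forall>v\<in>carrier_vec k. 0 \<le> qform A v)"
  then show "psd_mat k A"
    by (auto simp: psd_mat_def hermitian_mat_qform hermitian_matD less_eq_complex_def)
qed

lemma pd_mat_iff_qform:
  "pd_mat k A \<longleftrightarrow> hermitian_mat k A \<and> (\<forall>v\<in>carrier_vec k. v \<noteq> 0\<^sub>v k \<longrightarrow> 0 < qform A v)"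
proof
  assume pd: "pd_mat k A"
  have "Im ((A *\<^sub>v v) \<bullet>c v) = 0" if "v \<in> carrier_vec k" for v
  proof (cases "v = 0\<^sub>v k")
    case True
    then show ?thesis using pd by (auto simp: pd_mat_def scalar_prod_def)
  next
    case False
    then have "0 < (A *\<^sub>v v) \<bullet>c v" using pd that by (simp add: pd_mat_def)
    then show ?thesis by (simp add: less_complex_def)
  qed
  then have "hermitian_mat k A"
    using pd by (intro hermitian_mat_if_form_real) (auto simp: pd_mat_def)
  with pd show "hermitian_mat k A \<and> (\<forall>v\<in>carrier_vec k. v \<noteq> 0\<^sub>v k \<longrightarrow> 0 < qform A v)"
    by (auto simp: pd_mat_def qform_def less_complex_def)
next
  assume "hermitian_mat k A \<and> (\<forall>v\<in>carrier_vec k. v \<noteq> 0\<^sub>v k \<longrightarrow> 0 < qform A v)"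
  then show "pd_mat k A"
    by (auto simp: pd_mat_def hermitian_mat_qform hermitian_matD less_complex_def)
qed

lemma pd_mat_imp_psd_mat:
  assumes "pd_mat k A"
  shows "psd_mat k A"
proof -
  have "0 \<le> qform A v" if "v \<in> carrier_vec k" for v
  proof (cases "v = 0\<^sub>v k")
    case True
    then show ?thesis using assms by (auto simp: qform_def pd_mat_def scalar_prod_def)
  next
    case False
    then show ?thesis using assms that by (simp add: pd_mat_iff_qform less_imp_le)
  qed
  then show ?thesis using assms by (simp add: psd_mat_iff_qform pd_mat_iff_qform)
qed

lemma mat_le_iff_qform:
  assumes "hermitian_mat k A" "hermitian_mat k B"
  shows "mat_le k A B \<longleftrightarrow> (\<forall>v\<in>carrier_vec k. qform A v \<le> qform B v)"
  using assms
  by (simp add: mat_le_def psd_mat_iff_qform hermitian_matD hermitian_mat_minus qform_minus[of _ k])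

lemma mat_le_refl: "hermitian_mat k A \<Longrightarrow> mat_le k A A"
  by (simp add: mat_le_iff_qform)

lemma mat_leD:
  assumes "mat_le k A B"
  shows "v \<in> carrier_vec k \<Longrightarrow> qform A v \<le> qform B v"
  using assms by (auto simp: mat_le_def psd_mat_iff_qform qform_minus[of _ k])

lemma psd_mat_carrier: "psd_mat k A \<Longrightarrow> A \<in> carrier_mat k k"
  by (simp add: psd_mat_def)

lemma psd_mat_mat_adjoint: "psd_mat k A \<Longrightarrow> mat_adjoint A = A"
  by (simp add: psd_mat_iff_qform hermitian_mat_def)

lemma psd_mat_add: "psd_mat k A \<Longrightarrow> psd_mat k B \<Longrightarrow> psd_mat k (A + B)"
  by (auto simp: psd_mat_iff_qform hermitian_mat_add hermitian_matD qform_add[of _ k])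

lemma psd_mat_smult: "psd_mat k A \<Longrightarrow> c \<ge> 0 \<Longrightarrow> psd_mat k (complex_of_real c \<cdot>\<^sub>m A)"
  by (auto simp: psd_mat_iff_qform hermitian_mat_smult hermitian_matD qform_smult[of _ k])

lemma psd_mat_one [simp]: "psd_mat k (1\<^sub>m k)"
  by (simp add: psd_mat_iff_qform qform_one_nonneg)

lemma psd_mat_congruence:
  "psd_mat n A \<Longrightarrow> Z \<in> carrier_mat n m \<Longrightarrow> psd_mat m (mat_adjoint Z * A * Z)"
  by (auto simp: psd_mat_iff_qform hermitian_mat_congruence hermitian_matD qform_congruence[of _ n])

lemma psd_mat_adjoint_mult: "Z \<in> carrier_mat n m \<Longrightarrow> psd_mat m (mat_adjoint Z * Z)"
  using psd_mat_congruence[OF psd_mat_one, of Z n m] by simp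

lemma mat_le_trans:
  assumes "mat_le k A B" "mat_le k B C"
  shows "mat_le k A C"
proof -
  have carriers: "A \<in> carrier_mat k k" "B \<in> carrier_mat k k" "C \<in> carrier_mat k k"
    using assms by (auto simp: mat_le_def)
  then have "C - A = (C - B) + (B - A)"
    by (intro eq_matI) auto
  then show ?thesis
    using assms carriers psd_mat_add[of k "C - B" "B - A"] by (simp add: mat_le_def)
qed

lemma mat_le_add:
  assumes "mat_le k A B" "mat_le k C D"
  shows "mat_le k (A + C) (B + D)"
proof -
  have carriers: "A \<in> carrier_mat k k" "B \<in> carrier_mat k k" "C \<in> carrier_mat k k" "D \<in> carrier_mat k k"
    using assms by (auto simp: mat_le_def)
  then have "B + D - (A + C) = (B - A) + (D - C)"
    by (intro eq_matI) auto
  then show ?thesis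
    using assms carriers psd_mat_add[of k "B - A" "D - C"] by (simp add: mat_le_def)
qed

lemma mat_le_add_psd_mat:
  assumes "A \<in> carrier_mat k k" "psd_mat k B"
  shows "mat_le k A (A + B)"
proof -
  have "A + B - A = B"
    using assms psd_mat_carrier[OF assms(2)] by (intro eq_matI) auto
  then show ?thesis using assms psd_mat_carrier[OF assms(2)] by (simp add: mat_le_def)
qed

lemma mat_le_smult:
  assumes "mat_le k A B" "c \<ge> 0"
  shows "mat_le k (complex_of_real c \<cdot>\<^sub>m A) (complex_of_real c \<cdot>\<^sub>m B)"
proof -
  have "complex_of_real c \<cdot>\<^sub>m B - complex_of_real c \<cdot>\<^sub>m A = complex_of_real c \<cdot>\<^sub>m (B - A)"
    using assms by (intro eq_matI) (auto simp: mat_le_def algebra_simps)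
  then show ?thesis using assms psd_mat_smult[of k "B - A" c] by (simp add: mat_le_def)
qed

lemma mat_le_congruence:
  assumes "mat_le n A B" and Z: "Z \<in> carrier_mat n m"
  shows "mat_le m (mat_adjoint Z * A * Z) (mat_adjoint Z * B * Z)"
proof -
  have A: "A \<in> carrier_mat n n" and B: "B \<in> carrier_mat n n" and diff_psd: "psd_mat n (B - A)"
    using assms by (auto simp: mat_le_def)
  have Z': "mat_adjoint Z \<in> carrier_mat m n" using Z by simp
  have "mat_adjoint Z * B * Z - mat_adjoint Z * A * Z = mat_adjoint Z * (B - A) * Z"
    using A B Z Z' by (simp add: mult_minus_distrib_mat[of _ m n _ n]
      minus_mult_distrib_mat[of "mat_adjoint Z * B" m n] mult_carrier_mat[of _ m n _ n])
  then show ?thesis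
    using psd_mat_congruence[OF diff_psd Z]
    by (simp add: mat_le_def congruence_carrier[OF A Z] congruence_carrier[OF B Z] del: assoc_mult_mat)
qed

lemma mat_le_congruence_mult:
  assumes "mat_le q (mat_adjoint V * A * V) B"
    and A: "A \<in> carrier_mat p p" and V: "V \<in> carrier_mat p q" and R: "R \<in> carrier_mat q r"
  shows "mat_le r (mat_adjoint (V * R) * A * (V * R)) (mat_adjoint R * B * R)"
  unfolding congruence_mult[OF A V R] by (rule mat_le_congruence[OF assms(1) R])

lemma pd_mat_mono:
  assumes A: "pd_mat k A" and A_le_B: "mat_le k A B"
  shows "pd_mat k B"
proof -
  have "A + (B - A) = B"
    using A_le_B by (intro eq_matI) (auto simp: mat_le_def)
  then have "hermitian_mat k B"
    using A A_le_B hermitian_mat_add[of k A "B - A"]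
    by (simp add: pd_mat_iff_qform mat_le_def psd_mat_iff_qform)
  then show ?thesis
    using A mat_leD[OF A_le_B] by (force simp: pd_mat_iff_qform)
qed

lemma qform_add_le_young:
  assumes A: "psd_mat k A" and v: "v \<in> carrier_vec k" and w: "w \<in> carrier_vec k" and e: "e > 0"
  shows "qform A (v + w) \<le> (1 + e) * qform A v + (1 + 1 / e) * qform A w"
proof -
  have herm: "hermitian_mat k A" using A by (simp add: psd_mat_iff_qform)
  have "0 \<le> qform A (v + complex_of_real (- (1 / e)) \<cdot>\<^sub>v w)"
    using A v w by (simp add: psd_mat_iff_qform)
  then have "0 \<le> e * (qform A v + 2 * (- (1 / e)) * Re ((A *\<^sub>v v) \<bullet>c w) + (- (1 / e))\<^sup>2 * qform A w)"
    unfolding qform_add_smult[OF herm v w] using e by simp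
  then have "2 * Re ((A *\<^sub>v v) \<bullet>c w) \<le> e * qform A v + 1 / e * qform A w"
    using e by (simp add: algebra_simps power2_eq_square)
  then show ?thesis
    using qform_add_smult[OF herm v w, of 1] by (simp add: distrib_right)
qed

lemma qform_le_young_range_split:
  assumes A: "psd_mat p A" and Z: "Z \<in> carrier_mat p q" and x: "x \<in> carrier_vec p" and e: "e > 0"
  shows "qform A x \<le> (1 + e) * qform (mat_adjoint Z * A * Z) (mat_adjoint Z *\<^sub>v x)
    + (1 + 1 / e) * qform A (x - Z *\<^sub>v (mat_adjoint Z *\<^sub>v x))"
proof -
  define v where "v = mat_adjoint Z *\<^sub>v x"
  have v: "v \<in> carrier_vec q" using Z x by (simp add: v_def mult_mat_vec_carrier[of _ q p])
  have Zv: "Z *\<^sub>v v \<in> carrier_vec p" using Z v by (rule mult_mat_vec_carrier)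
  have "x = Z *\<^sub>v v + (x - Z *\<^sub>v v)" using x Z by (intro eq_vecI) auto
  then have "qform A x \<le> (1 + e) * qform A (Z *\<^sub>v v) + (1 + 1 / e) * qform A (x - Z *\<^sub>v v)"
    using qform_add_le_young[OF A Zv _ e, of "x - Z *\<^sub>v v"] x Zv by simp
  then show ?thesis
    using qform_congruence[OF psd_mat_carrier[OF A] Z v] by (simp add: v_def)
qed

lemma qform_inverse_ge:
  assumes A: "psd_mat k A" and A': "hermitian_mat k A'" "A * A' = 1\<^sub>m k"
    and v: "v \<in> carrier_vec k" and w: "w \<in> carrier_vec k"
  shows "2 * Re (v \<bullet>c w) - qform A w \<le> qform A' v"
proof -
  have A'v: "A' *\<^sub>v v \<in> carrier_vec k"
    using hermitian_matD(1)[OF A'(1)] v by (rule mult_mat_vec_carrier)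
  have AA'v: "A *\<^sub>v (A' *\<^sub>v v) = v"
    using assoc_mult_mat_vec[OF psd_mat_carrier[OF A] hermitian_matD(1)[OF A'(1)] v] A'(2) v by simp
  have "0 \<le> qform A (A' *\<^sub>v v + complex_of_real (- 1) \<cdot>\<^sub>v w)"
    using A A'v w by (simp add: psd_mat_iff_qform)
  moreover have "qform A (A' *\<^sub>v v) = qform A' v"
    by (simp add: qform_def AA'v cscalar_prod_commute[OF A'v v])
  ultimately show ?thesis
    using qform_add_smult[OF _ A'v w, of A "- 1"] A by (simp add: AA'v psd_mat_iff_qform)
qed

lemma congruence_le_imp_inverse_congruence_le:
  assumes V: "V \<in> carrier_mat p q" and A: "psd_mat p A" and G: "hermitian_mat q G"
    and congruence_le: "mat_le q (mat_adjoint V * A * V) G"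
    and A': "hermitian_mat p A'" "A * A' = 1\<^sub>m p" and G': "hermitian_mat q G'" "G' * G * G' = G'"
  shows "mat_le p (V * G' * mat_adjoint V) A'"
proof -
  note G'_carrier = hermitian_matD(1)[OF G'(1)]
  have "qform (V * G' * mat_adjoint V) v \<le> qform A' v" if v: "v \<in> carrier_vec p" for v
  proof -
    define z where "z = mat_adjoint V *\<^sub>v v"
    define x where "x = G' *\<^sub>v z"
    have z: "z \<in> carrier_vec q" using V v by (simp add: z_def mult_mat_vec_carrier[of _ q p])
    have x: "x \<in> carrier_vec q" unfolding x_def using G'_carrier z by (rule mult_mat_vec_carrier)
    have "qform A (V *\<^sub>v x) \<le> qform G x"
      using mat_leD[OF congruence_le x] qform_congruence[OF psd_mat_carrier[OF A] V x] by simp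
    also have "qform G x = qform (mat_adjoint G' * G * G') z"
      unfolding x_def by (rule qform_congruence[OF hermitian_matD(1)[OF G] G'_carrier z, symmetric])
    also have "\<dots> = qform G' z" using hermitian_matD(2)[OF G'(1)] G'(2) by simp
    finally have Vx_le: "qform A (V *\<^sub>v x) \<le> qform G' z" .
    have "Re (v \<bullet>c (V *\<^sub>v x)) = qform G' z"
      using cscalar_prod_mat_adjoint[of "mat_adjoint V" q p v x] V v x
        hermitian_mat_cscalar_prod[OF G'(1)] cscalar_prod_commute[OF x z]
      by (simp add: z_def[symmetric] qform_def x_def)
    then have "qform G' z \<le> qform A' v"
      using qform_inverse_ge[OF A A' v mult_mat_vec_carrier[OF V x]] Vx_le by simp
    then show ?thesis
      using qform_congruence_adjoint[OF G'_carrier V v] by (simp add: z_def)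
  qed
  then show ?thesis
    using A'(1) G'(1) V by (simp add: mat_le_iff_qform hermitian_mat_congruence_adjoint)
qed

section \<open>The spectral theorem\<close>

definition unitary_mat :: "nat \<Rightarrow> complex mat \<Rightarrow> bool" where
  "unitary_mat k U \<longleftrightarrow> U \<in> carrier_mat k k \<and> mat_adjoint U * U = 1\<^sub>m k \<and> U * mat_adjoint U = 1\<^sub>m k"

lemma unitary_matD:
  assumes "unitary_mat k U"
  shows "U \<in> carrier_mat k k" "mat_adjoint U * U = 1\<^sub>m k" "U * mat_adjoint U = 1\<^sub>m k"
  using assms by (auto simp: unitary_mat_def)

lemma unitary_matI:
  assumes "U \<in> carrier_mat k k" "mat_adjoint U * U = 1\<^sub>m k"
  shows "unitary_mat k U"
  using assms mat_mult_left_right_inverse[of "mat_adjoint U" k U] by (simp add: unitary_mat_def)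

lemma unitary_mat_one [simp]: "unitary_mat k (1\<^sub>m k)"
  by (simp add: unitary_mat_def)

lemma unitary_mat_mult:
  assumes U: "unitary_mat k U" and V: "unitary_mat k V"
  shows "unitary_mat k (U * V)"
proof (rule unitary_matI)
  note Uc = unitary_matD(1)[OF U] and Vc = unitary_matD(1)[OF V]
  have "mat_adjoint (U * V) * (U * V) = mat_adjoint V * ((mat_adjoint U * U) * V)"
    using Uc Vc by (simp add: mat_adjoint_mult[of _ k k _ k] assoc_mult_mat[of _ k k _ k _ k])
  then show "mat_adjoint (U * V) * (U * V) = 1\<^sub>m k"
    using Vc unitary_matD(2)[OF U] unitary_matD(2)[OF V] by simp
qed (use assms in \<open>auto simp: unitary_mat_def\<close>)

lemma unitary_mat_four_block_diag:
  assumes "unitary_mat n U" "unitary_mat m V"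
  shows "unitary_mat (n + m) (four_block_mat U (0\<^sub>m n m) (0\<^sub>m m n) V)"
  using assms
  by (intro unitary_matI)
    (auto simp: unitary_mat_def mat_adjoint_four_block_diag mult_four_block_diag)

definition rdiag :: "nat \<Rightarrow> (nat \<Rightarrow> real) \<Rightarrow> complex mat" where
  "rdiag k d = mat_diag k (\<lambda>i. complex_of_real (d i))"

lemma rdiag_carrier [simp]: "rdiag k d \<in> carrier_mat k k"
  by (simp add: rdiag_def)

lemma rdiag_dim [simp]: "dim_row (rdiag k d) = k" "dim_col (rdiag k d) = k"
  by (simp_all add: rdiag_def mat_diag_def)

lemma rdiag_index [simp]:
  "i < k \<Longrightarrow> j < k \<Longrightarrow> rdiag k d $$ (i, j) = (if i = j then complex_of_real (d i) else 0)"
  by (simp add: rdiag_def mat_diag_def)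

lemma rdiag_cong: "(\<And>i. i < k \<Longrightarrow> a i = b i) \<Longrightarrow> rdiag k a = rdiag k b"
  by (rule eq_matI) auto

lemma rdiag_const: "rdiag k (\<lambda>_. c) = complex_of_real c \<cdot>\<^sub>m 1\<^sub>m k"
  by (rule eq_matI) auto

lemma rdiag_one [simp]: "rdiag k (\<lambda>_. 1) = 1\<^sub>m k"
  by (rule eq_matI) auto

lemma rdiag_mult_rdiag [simp]: "rdiag k a * rdiag k b = rdiag k (\<lambda>i. a i * b i)"
  by (simp add: rdiag_def)

lemma mult_rdiag:
  "A \<in> carrier_mat n k \<Longrightarrow> A * rdiag k d = mat n k (\<lambda>(i, j). A $$ (i, j) * complex_of_real (d j))"
  by (simp add: rdiag_def mat_diag_mult_right)

lemma rdiag_mult: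
  "A \<in> carrier_mat k n \<Longrightarrow> rdiag k d * A = mat k n (\<lambda>(i, j). complex_of_real (d i) * A $$ (i, j))"
  by (simp add: rdiag_def mat_diag_mult_left)

lemma mult_eq_mult_rdiagI:
  assumes A: "A \<in> carrier_mat p p" and X: "X \<in> carrier_mat p q"
    and eigen: "\<And>j. j < q \<Longrightarrow> A *\<^sub>v col X j = complex_of_real (d j) \<cdot>\<^sub>v col X j"
  shows "A * X = X * rdiag q d"
proof (rule mat_col_eqI)
  fix j assume "j < dim_col (X * rdiag q d)"
  then have j: "j < q" by simp
  have "col (A * X) j = complex_of_real (d j) \<cdot>\<^sub>v col X j"
    using col_mult2[OF A X j] eigen[OF j] by simp
  also have "\<dots> = col (X * rdiag q d) j"
    unfolding mult_rdiag[OF X] using X j by (intro eq_vecI) auto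
  finally show "col (A * X) j = col (X * rdiag q d) j" .
qed (use A X in auto)

lemma mult_rdiag_eq_self:
  assumes V: "V \<in> carrier_mat p q" and col: "\<And>j. j < q \<Longrightarrow> r j \<noteq> 1 \<Longrightarrow> col V j = 0\<^sub>v p"
  shows "V * rdiag q r = V"
proof (rule eq_matI)
  fix i j assume "i < dim_row V" "j < dim_col V"
  then have ij: "i < p" "j < q" using V by auto
  then have "r j = 1 \<or> V $$ (i, j) = 0"
    using arg_cong[OF col[of j], of "\<lambda>v. v $ i"] V by auto
  then show "(V * rdiag q r) $$ (i, j) = V $$ (i, j)"
    using V ij by (auto simp: mult_rdiag)
qed (use V in auto)

lemma mat_adjoint_rdiag [simp]: "mat_adjoint (rdiag k d) = rdiag k d"
  by (rule eq_matI) auto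

lemma hermitian_mat_rdiag [simp]: "hermitian_mat k (rdiag k d)"
  by (simp add: hermitian_mat_def)

lemma rdiag_mult_vec:
  assumes "v \<in> carrier_vec k"
  shows "rdiag k d *\<^sub>v v = vec k (\<lambda>i. complex_of_real (d i) * v $ i)"
proof (rule eq_vecI)
  fix i assume "i < dim_vec (vec k (\<lambda>i. complex_of_real (d i) * v $ i))"
  then have i: "i < k" by simp
  then show "(rdiag k d *\<^sub>v v) $ i = vec k (\<lambda>i. complex_of_real (d i) * v $ i) $ i"
    using assms by (simp add: rdiag_def mat_diag_def scalar_prod_def if_distrib[of "\<lambda>x. x * _"] cong: if_cong)
qed simp

lemma rdiag_mult_vec_carrier [simp]: "rdiag k d *\<^sub>v v \<in> carrier_vec k"
  by (rule carrier_vecI) simp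

lemma qform_rdiag:
  assumes "v \<in> carrier_vec k"
  shows "qform (rdiag k d) v = (\<Sum>i<k. d i * (cmod (v $ i))\<^sup>2)"
proof -
  have "(rdiag k d *\<^sub>v v) \<bullet>c v = (\<Sum>i<k. complex_of_real (d i * (cmod (v $ i))\<^sup>2))"
    unfolding rdiag_mult_vec[OF assms] scalar_prod_def using assms
    by (auto simp: lessThan_atLeast0 complex_norm_square mult.assoc simp del: of_real_power
        intro!: sum.cong)
  then show ?thesis by (simp add: qform_def)
qed

definition unitary_diag :: "nat \<Rightarrow> complex mat \<Rightarrow> (nat \<Rightarrow> real) \<Rightarrow> complex mat" where
  "unitary_diag k U d = U * rdiag k d * mat_adjoint U"

lemma hermitian_mat_unitary_diag:
  assumes "U \<in> carrier_mat k k"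
  shows "hermitian_mat k (unitary_diag k U d)"
  unfolding unitary_diag_def using assms by (intro hermitian_mat_congruence_adjoint) auto

lemma unitary_diag_carrier [simp]: "U \<in> carrier_mat k k \<Longrightarrow> unitary_diag k U d \<in> carrier_mat k k"
  using hermitian_matD(1)[OF hermitian_mat_unitary_diag] .

lemma unitary_diag_one: "unitary_diag k (1\<^sub>m k) d = rdiag k d"
  by (simp add: unitary_diag_def right_mult_one_mat[of _ k k] left_mult_one_mat[of _ k k])

lemma unitary_diag_eqI:
  assumes "unitary_mat k U" "A \<in> carrier_mat k k" "A * U = U * rdiag k d"
  shows "A = unitary_diag k U d"
proof -
  have "unitary_diag k U d = A * (U * mat_adjoint U)"
    using assms unfolding unitary_diag_def assms(3)[symmetric]
    by (intro assoc_mult_mat[of _ k k _ k _ k]) (auto simp: unitary_mat_def)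
  then show ?thesis using assms by (simp add: unitary_mat_def)
qed

lemma unitary_diag_mult:
  assumes "unitary_mat k U"
  shows "unitary_diag k U d * U = U * rdiag k d"
proof -
  have "unitary_diag k U d * U = U * rdiag k d * (mat_adjoint U * U)"
    using assms unfolding unitary_diag_def
    by (intro assoc_mult_mat[of _ k k _ k _ k])
      (auto simp: unitary_mat_def intro!: mult_carrier_mat[of _ k k])
  then show ?thesis
    using assms by (simp add: unitary_mat_def right_mult_one_mat[of _ k k] mult_carrier_mat[of _ k k])
qed

lemma unitary_diag_mult_col:
  assumes U: "unitary_mat k U" and i: "i < k"
  shows "unitary_diag k U d *\<^sub>v col U i = complex_of_real (d i) \<cdot>\<^sub>v col U i"
proof -
  note Uc = unitary_matD(1)[OF U]
  have "unitary_diag k U d *\<^sub>v col U i = col (unitary_diag k U d * U) i"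
    using Uc i by (intro col_mult2[symmetric, of _ k k]) auto
  also have "\<dots> = complex_of_real (d i) \<cdot>\<^sub>v col U i"
    unfolding unitary_diag_mult[OF U] mult_rdiag[OF Uc]
    using Uc i by (intro eq_vecI) auto
  finally show ?thesis .
qed

lemma unitary_diag_add_smult_one:
  assumes U: "unitary_mat k U"
  shows "unitary_diag k U d + complex_of_real c \<cdot>\<^sub>m 1\<^sub>m k = unitary_diag k U (\<lambda>i. d i + c)"
proof (rule unitary_diag_eqI[OF U])
  note Uc = unitary_matD(1)[OF U]
  have "(unitary_diag k U d + complex_of_real c \<cdot>\<^sub>m 1\<^sub>m k) * U = U * rdiag k d + complex_of_real c \<cdot>\<^sub>m U"
    using Uc by (simp add: add_mult_distrib_mat[of _ k k] mult_smult_assoc_mat[of _ k k] unitary_diag_mult[OF U])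
  also have "\<dots> = U * rdiag k (\<lambda>i. d i + c)"
    unfolding mult_rdiag[OF Uc] using Uc by (intro eq_matI) (auto simp: algebra_simps)
  finally show "(unitary_diag k U d + complex_of_real c \<cdot>\<^sub>m 1\<^sub>m k) * U = U * rdiag k (\<lambda>i. d i + c)" .
qed (use unitary_matD(1)[OF U] in auto)

lemma qform_unitary_diag:
  assumes "U \<in> carrier_mat k k" "v \<in> carrier_vec k"
  shows "qform (unitary_diag k U d) v = (\<Sum>i<k. d i * (cmod ((mat_adjoint U *\<^sub>v v) $ i))\<^sup>2)"
  unfolding unitary_diag_def using assms
  by (simp add: qform_congruence_adjoint[of _ k] qform_rdiag mult_mat_vec_carrier[of _ k k])

lemma unitary_mat_adjoint_mult_col:
  assumes U: "unitary_mat k U" and i: "i < k"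
  shows "mat_adjoint U *\<^sub>v col U i = unit_vec k i"
  using unitary_matD[OF U] i col_mult2[of "mat_adjoint U" k k U k i] by simp

lemma unitary_mat_col_neq_0:
  assumes U: "unitary_mat k U" and i: "i < k"
  shows "col U i \<noteq> 0\<^sub>v k"
proof
  assume "col U i = 0\<^sub>v k"
  then have "unit_vec k i = mat_adjoint U *\<^sub>v 0\<^sub>v k"
    using unitary_mat_adjoint_mult_col[OF U i] by simp
  also have "\<dots> = 0\<^sub>v k"
    using unitary_matD(1)[OF U] by (intro eq_vecI) auto
  finally show False using i by simp
qed

lemma qform_unitary_diag_col:
  assumes U: "unitary_mat k U" and i: "i < k"
  shows "qform (unitary_diag k U d) (col U i) = d i"
proof -
  have "qform (unitary_diag k U d) (col U i) = (\<Sum>j<k. d j * (cmod (unit_vec k i $ j))\<^sup>2)"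
    using unitary_matD(1)[OF U] i by (simp add: qform_unitary_diag unitary_mat_adjoint_mult_col[OF U i])
  also have "\<dots> = (\<Sum>j<k. if j = i then d j else 0)"
    using i by (intro sum.cong) auto
  finally show ?thesis using i by simp
qed

lemma unitary_mat_mult_vec_neq_0:
  assumes U: "unitary_mat k U" and v: "v \<in> carrier_vec k" "v \<noteq> 0\<^sub>v k"
  obtains i where "i < k" "(mat_adjoint U *\<^sub>v v) $ i \<noteq> 0"
proof -
  note Uc = unitary_matD[OF U]
  have "v = U *\<^sub>v (mat_adjoint U *\<^sub>v v)"
    using Uc v by (simp flip: assoc_mult_mat_vec[of _ k k _ k])
  then have "mat_adjoint U *\<^sub>v v \<noteq> 0\<^sub>v k"
    using v Uc by auto
  then show thesis
    using that Uc(1) by (metis carrier_matD(2) dim_mult_mat_vec eq_vecI index_zero_vec mat_adjoint_dim(1))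
qed

lemma psd_mat_unitary_diag_iff:
  assumes U: "unitary_mat k U"
  shows "psd_mat k (unitary_diag k U d) \<longleftrightarrow> (\<forall>i<k. 0 \<le> d i)"
proof
  assume "psd_mat k (unitary_diag k U d)"
  then show "\<forall>i<k. 0 \<le> d i"
    using unitary_matD(1)[OF U]
    by (auto simp: psd_mat_iff_qform simp flip: qform_unitary_diag_col[OF U])
next
  assume "\<forall>i<k. 0 \<le> d i"
  then show "psd_mat k (unitary_diag k U d)"
    using unitary_matD(1)[OF U]
    by (auto simp: psd_mat_iff_qform hermitian_mat_unitary_diag qform_unitary_diag intro!: sum_nonneg)
qed

lemma pd_mat_unitary_diag_iff:
  assumes U: "unitary_mat k U"
  shows "pd_mat k (unitary_diag k U d) \<longleftrightarrow> (\<forall>i<k. 0 < d i)"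
proof
  note Uc = unitary_matD(1)[OF U]
  assume pd: "pd_mat k (unitary_diag k U d)"
  show "\<forall>i<k. 0 < d i"
  proof (intro allI impI)
    fix i assume i: "i < k"
    show "0 < d i"
      using pd Uc i unitary_mat_col_neq_0[OF U i]
      by (auto simp: pd_mat_iff_qform simp flip: qform_unitary_diag_col[OF U i, of d])
  qed
next
  note Uc = unitary_matD(1)[OF U]
  assume d: "\<forall>i<k. 0 < d i"
  have "0 < qform (unitary_diag k U d) v" if v: "v \<in> carrier_vec k" "v \<noteq> 0\<^sub>v k" for v
  proof -
    obtain i where "i < k" "(mat_adjoint U *\<^sub>v v) $ i \<noteq> 0"
      using unitary_mat_mult_vec_neq_0[OF U v] .
    then show ?thesis
      using d Uc v(1) by (auto simp: qform_unitary_diag intro!: sum_pos2[of _ i] mult_nonneg_nonneg)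
  qed
  then show "pd_mat k (unitary_diag k U d)"
    using Uc by (simp add: pd_mat_iff_qform hermitian_mat_unitary_diag)
qed

lemma pd_mat_rdiag_iff: "pd_mat k (rdiag k d) \<longleftrightarrow> (\<forall>i<k. 0 < d i)"
  using pd_mat_unitary_diag_iff[OF unitary_mat_one, of k d] by (simp add: unitary_diag_one)

lemma mat_le_rdiag_iff: "mat_le k (rdiag k a) (rdiag k b) \<longleftrightarrow> (\<forall>i<k. a i \<le> b i)"
proof -
  have "rdiag k b - rdiag k a = unitary_diag k (1\<^sub>m k) (\<lambda>i. b i - a i)"
    unfolding unitary_diag_one by (rule eq_matI) auto
  then show ?thesis
    by (simp add: mat_le_def psd_mat_unitary_diag_iff)
qed

lemma pd_mat_smult_one: "c > 0 \<Longrightarrow> pd_mat k (complex_of_real c \<cdot>\<^sub>m 1\<^sub>m k)"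
  using pd_mat_unitary_diag_iff[OF unitary_mat_one, of k "\<lambda>_. c"]
  by (simp add: unitary_diag_one rdiag_const)

lemma unitary_diag_four_block:
  assumes "U \<in> carrier_mat n n" "V \<in> carrier_mat m m"
  shows "four_block_mat (unitary_diag n U d) (0\<^sub>m n m) (0\<^sub>m m n) (unitary_diag m V e)
    = unitary_diag (n + m) (four_block_mat U (0\<^sub>m n m) (0\<^sub>m m n) V)
        (\<lambda>i. if i < n then d i else e (i - n))"
proof -
  have "rdiag (n + m) (\<lambda>i. if i < n then d i else e (i - n))
      = four_block_mat (rdiag n d) (0\<^sub>m n m) (0\<^sub>m m n) (rdiag m e)"
    by (rule eq_matI) auto
  then show ?thesis
    using assms
    by (simp add: unitary_diag_def mat_adjoint_four_block_diag mult_four_block_diag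
        mult_carrier_mat[of _ n n]
        mult_carrier_mat[of _ m m])
qed

lemma unitary_diag_conjugation:
  assumes "U \<in> carrier_mat k k" "V \<in> carrier_mat k k"
  shows "U * unitary_diag k V d * mat_adjoint U = unitary_diag k (U * V) d"
  using assms unfolding unitary_diag_def
  by (simp add: mat_adjoint_mult[of _ k k _ k] assoc_mult_mat[of _ k k _ k _ k]
      mult_carrier_mat[of _ k k _ k])

lemma corthogonal_mat_normalize:
  fixes W :: "complex mat"
  assumes W: "W \<in> carrier_mat n n" and orth: "corthogonal_mat W"
  obtains r where "unitary_mat n (W * rdiag n r)"
proof
  define r where "r i = 1 / sqrt (Re (col W i \<bullet>c col W i))" for i
  have r_col: "complex_of_real (r i * r i) * (col W i \<bullet>c col W i) = 1" if i: "i < n" for i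
  proof -
    have "0 < col W i \<bullet>c col W i"
      using corthogonal_matD[OF orth, of i i] i W conjugate_square_ge_0_vec[of "col W i"]
      by (simp add: order_less_le)
    then have "0 < Re (col W i \<bullet>c col W i)" "Im (col W i \<bullet>c col W i) = 0"
      by (auto simp: less_complex_def)
    then show ?thesis by (simp add: r_def complex_eq_iff)
  qed
  show "unitary_mat n (W * rdiag n r)"
  proof (rule unitary_matI)
    have "mat_adjoint (W * rdiag n r) * (W * rdiag n r)
        = rdiag n r * ((mat_adjoint W * 1\<^sub>m n * W) * rdiag n r)"
      using W by (simp add: mat_adjoint_mult[of _ n n _ n] assoc_mult_mat[of _ n n _ n _ n]
        mult_carrier_mat[of _ n n] right_mult_one_mat[of _ n n])
    also have "\<dots> = mat n n (\<lambda>(i, j). complex_of_real (r i * r j) * (col W j \<bullet>c col W i))"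
      using W cscalar_prod_mult_col[of "1\<^sub>m n" n n W n W n] congruence_carrier[of "1\<^sub>m n" n W n]
      by (subst mult_rdiag[of _ n], force, subst rdiag_mult[of _ _ n], force)
        (auto intro!: eq_matI)
    also have "\<dots> = 1\<^sub>m n"
      using W r_col corthogonal_matD[OF orth] by (intro eq_matI) auto
    finally show "mat_adjoint (W * rdiag n r) * (W * rdiag n r) = 1\<^sub>m n" .
  qed (use W in \<open>auto intro: mult_carrier_mat\<close>)
qed

lemma unitary_completion:
  fixes v :: "complex vec"
  assumes v: "v \<in> carrier_vec n" "v \<noteq> 0\<^sub>v n"
  obtains U c where "unitary_mat n U" "col U 0 = c \<cdot>\<^sub>v v"
proof -
  interpret cof_vec_space n "TYPE(complex)" .
  let ?basis = "basis_completion v"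
  define ws where "ws = gram_schmidt n ?basis"
  note basis = basis_completion[OF v]
  obtain vs where basis_Cons: "?basis = v # vs"
    using basis(6,7) v by (cases ?basis) auto
  have ws: "set ws \<subseteq> carrier_vec n" "corthogonal ws" "length ws = n"
    using gram_schmidt_result[OF basis(2,4,5) ws_def] basis(6) by auto
  have n: "0 < n" using v by (cases n) auto
  have "ws ! 0 = v"
    using gram_schmidt_hd[OF v(1), of vs] ws(3) n hd_conv_nth[of ws]
    by (metis list.size(3) not_less_zero basis_Cons ws_def)
  then have col0: "col (mat_of_cols n ws) 0 = v"
    using ws n v by simp
  have "mat_of_cols n ws \<in> carrier_mat n n" using ws(3) mat_of_cols_carrier(1)[of n ws] by simp
  then obtain r where "unitary_mat n (mat_of_cols n ws * rdiag n r)"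
    using orthogonal_mat_of_cols[OF ws] by (rule corthogonal_mat_normalize)
  moreover have "col (mat_of_cols n ws * rdiag n r) 0 = complex_of_real (r 0) \<cdot>\<^sub>v v"
    using ws(3) n v(1) unfolding col0[symmetric]
    by (subst mult_rdiag[of _ n]) (auto intro!: eq_vecI)
  ultimately show thesis by (rule that)
qed

lemma hermitian_mat_four_block:
  assumes B: "hermitian_mat (Suc k) B" and col: "col B 0 = e \<cdot>\<^sub>v unit_vec (Suc k) 0"
  obtains r C where "hermitian_mat k C" "B = four_block_mat (rdiag 1 (\<lambda>_. r)) (0\<^sub>m 1 k) (0\<^sub>m k 1) C"
proof
  note Bc = hermitian_matD(1)[OF B]
  define C where "C = mat k k (\<lambda>(i, j). B $$ (Suc i, Suc j))"
  have herm: "B $$ (i, j) = cnj (B $$ (j, i))" if "i < Suc k" "j < Suc k" for i j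
    using hermitian_matD(2)[OF B] Bc that mat_adjoint_index[of i B j] by simp
  have col0: "B $$ (i, 0) = (if i = 0 then e else 0)" if "i < Suc k" for i
    using arg_cong[OF col, of "\<lambda>v. v $ i"] Bc that by auto
  have e_real: "cnj e = e"
    using herm[of 0 0] col0[of 0] by simp
  have row0: "B $$ (0, j) = (if j = 0 then e else 0)" if "j < Suc k" for j
    using herm[OF _ that, of 0] col0[OF that] e_real by (simp split: if_splits)
  show "hermitian_mat k C"
    unfolding hermitian_mat_def by (auto simp: C_def herm[symmetric])
  show "B = four_block_mat (rdiag 1 (\<lambda>_. Re e)) (0\<^sub>m 1 k) (0\<^sub>m k 1) C"
    by (rule eq_matI) (use Bc col0 row0 e_real in \<open>auto simp: C_def complex_eq_iff\<close>)
qed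

lemma unitary_conjugation_col_eigenvector:
  assumes U: "unitary_mat n U" and A: "A \<in> carrier_mat n n"
    and j: "j < n" and eigen: "A *\<^sub>v col U j = e \<cdot>\<^sub>v col U j"
  shows "col (mat_adjoint U * A * U) j = e \<cdot>\<^sub>v unit_vec n j"
proof -
  note Uc = unitary_matD(1)[OF U]
  have "col (mat_adjoint U * A * U) j = (mat_adjoint U * A) *\<^sub>v col U j"
    using A Uc j by (intro col_mult2[of _ n n _ n]) auto
  also have "\<dots> = mat_adjoint U *\<^sub>v (A *\<^sub>v col U j)"
    using A Uc j by (intro assoc_mult_mat_vec[of _ n n _ n]) auto
  also have "\<dots> = e \<cdot>\<^sub>v (mat_adjoint U *\<^sub>v col U j)"
    unfolding eigen using Uc j by (intro mult_mat_vec[of _ n n]) auto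
  finally show ?thesis by (simp add: unitary_mat_adjoint_mult_col[OF U j])
qed

lemma hermitian_mat_deflation:
  assumes A: "hermitian_mat (Suc k) A"
  obtains U r C where "unitary_mat (Suc k) U" "hermitian_mat k C"
    "A = U * four_block_mat (rdiag 1 (\<lambda>_. r)) (0\<^sub>m 1 k) (0\<^sub>m k 1) C * mat_adjoint U"
proof -
  note Ac = hermitian_matD(1)[OF A]
  obtain e v where "eigenvector A v e"
    using spectrum_non_empty[OF Ac] unfolding spectrum_def eigenvalue_def by auto
  then have v: "v \<in> carrier_vec (Suc k)" "v \<noteq> 0\<^sub>v (Suc k)" "A *\<^sub>v v = e \<cdot>\<^sub>v v"
    using Ac by (auto simp: eigenvector_def)
  obtain U c where U: "unitary_mat (Suc k) U" and Uv: "col U 0 = c \<cdot>\<^sub>v v"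
    using unitary_completion[OF v(1,2)] .
  note Uc = unitary_matD[OF U]
  define B where "B = mat_adjoint U * A * U"
  have "A *\<^sub>v col U 0 = e \<cdot>\<^sub>v col U 0"
    unfolding Uv using Ac v
    by (simp add: mult_mat_vec[of _ "Suc k" "Suc k"] smult_smult_assoc mult.commute)
  then have "col B 0 = e \<cdot>\<^sub>v unit_vec (Suc k) 0"
    unfolding B_def using U Ac by (intro unitary_conjugation_col_eigenvector) auto
  moreover have "hermitian_mat (Suc k) B"
    unfolding B_def by (rule hermitian_mat_congruence[OF A Uc(1)])
  ultimately obtain r C where "hermitian_mat k C"
    "B = four_block_mat (rdiag 1 (\<lambda>_. r)) (0\<^sub>m 1 k) (0\<^sub>m k 1) C"
    using hermitian_mat_four_block by blast
  moreover have "U * B * mat_adjoint U = (U * mat_adjoint U) * A * (U * mat_adjoint U)"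
    unfolding B_def using Uc(1) Ac
    by (simp add: assoc_mult_mat[of _ "Suc k" "Suc k" _ "Suc k" _ "Suc k"]
        mult_carrier_mat[of _ "Suc k" "Suc k"])
  then have "A = U * B * mat_adjoint U" using Uc(3) Ac by simp
  ultimately show thesis using that U by blast
qed

theorem hermitian_mat_spectral:
  assumes "hermitian_mat k A"
  obtains U d where "unitary_mat k U" "A = unitary_diag k U d"
proof -
  have "\<exists>U d. unitary_mat k U \<and> A = unitary_diag k U d"
    using assms
  proof (induction k arbitrary: A)
    case 0
    then have "A = unitary_diag 0 (1\<^sub>m 0) (\<lambda>_. 0)"
      by (intro eq_matI) (auto simp: hermitian_mat_def unitary_diag_def)
    then show ?case using unitary_mat_one by blast
  next
    case (Suc k)
    obtain U r C where U: "unitary_mat (Suc k) U" and C: "hermitian_mat k C"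
      and A: "A = U * four_block_mat (rdiag 1 (\<lambda>_. r)) (0\<^sub>m 1 k) (0\<^sub>m k 1) C * mat_adjoint U"
      using hermitian_mat_deflation[OF Suc.prems] .
    obtain V d where V: "unitary_mat k V" and CV: "C = unitary_diag k V d"
      using Suc.IH[OF C] by blast
    define W where "W = four_block_mat (1\<^sub>m 1) (0\<^sub>m 1 k) (0\<^sub>m k 1) V"
    have W: "unitary_mat (Suc k) W"
      unfolding W_def using unitary_mat_four_block_diag[OF unitary_mat_one[of 1] V] by simp
    have "four_block_mat (rdiag 1 (\<lambda>_. r)) (0\<^sub>m 1 k) (0\<^sub>m k 1) C
        = unitary_diag (Suc k) W (\<lambda>i. if i < 1 then r else d (i - 1))"
      unfolding CV unitary_diag_one[symmetric] W_def
      using unitary_diag_four_block[OF one_carrier_mat unitary_matD(1)[OF V], of 1 "\<lambda>_. r" d] by simp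
    then have "A = unitary_diag (Suc k) (U * W) (\<lambda>i. if i < 1 then r else d (i - 1))"
      unfolding A using unitary_diag_conjugation unitary_matD(1)[OF U] unitary_matD(1)[OF W] by simp
    then show ?case using unitary_mat_mult[OF U W] by blast
  qed
  then show thesis using that by blast
qed

lemma psd_mat_spectral:
  assumes "psd_mat k A"
  obtains U d where "unitary_mat k U" "A = unitary_diag k U d" "\<And>i. i < k \<Longrightarrow> 0 \<le> d i"
proof -
  obtain U d where "unitary_mat k U" "A = unitary_diag k U d"
    using hermitian_mat_spectral[of k A] assms by (metis psd_mat_iff_qform)
  then show thesis using that assms psd_mat_unitary_diag_iff by blast
qed

lemma pd_mat_spectral:
  assumes "pd_mat k A"
  obtains U d where "unitary_mat k U" "A = unitary_diag k U d" "\<And>i. i < k \<Longrightarrow> 0 < d i"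
proof -
  obtain U d where "unitary_mat k U" "A = unitary_diag k U d"
    using hermitian_mat_spectral[of k A] assms by (metis pd_mat_iff_qform)
  then show thesis using that assms pd_mat_unitary_diag_iff by blast
qed

lemma psd_mat_factorization:
  assumes "psd_mat k A"
  obtains N where "N \<in> carrier_mat k k" "A = mat_adjoint N * N"
proof -
  obtain U d where U: "unitary_mat k U" and A: "A = unitary_diag k U d" and d: "\<And>i. i < k \<Longrightarrow> 0 \<le> d i"
    using psd_mat_spectral[OF assms] by metis
  let ?R = "rdiag k (\<lambda>i. sqrt (d i))"
  note Uc = unitary_matD(1)[OF U]
  have "mat_adjoint (?R * mat_adjoint U) * (?R * mat_adjoint U) = U * (?R * ?R) * mat_adjoint U"
    using Uc by (simp add: mat_adjoint_mult[of _ k k _ k] assoc_mult_mat[of _ k k _ k _ k]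
      mult_carrier_mat[of _ k k] del: rdiag_mult_rdiag)
  also have "?R * ?R = rdiag k d"
    unfolding rdiag_mult_rdiag using d by (intro rdiag_cong) simp
  finally have "A = mat_adjoint (?R * mat_adjoint U) * (?R * mat_adjoint U)"
    by (simp add: A unitary_diag_def)
  moreover have "?R * mat_adjoint U \<in> carrier_mat k k"
    using Uc by (intro mult_carrier_mat[of _ k k]) auto
  ultimately show thesis using that by blast
qed

lemma psd_mat_qform_le_smult_one:
  assumes "psd_mat k A"
  obtains c where "c > 0" "\<And>v. v \<in> carrier_vec k \<Longrightarrow> qform A v \<le> c * qform (1\<^sub>m k) v"
proof -
  obtain U d where U: "unitary_mat k U" and A: "A = unitary_diag k U d" and d: "\<And>i. i < k \<Longrightarrow> 0 \<le> d i"
    using psd_mat_spectral[OF assms] by metis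
  note Uc = unitary_matD[OF U]
  have one_diag: "1\<^sub>m k = unitary_diag k U (\<lambda>_. 1)"
    using Uc unfolding unitary_diag_def by (simp add: right_mult_one_mat[of _ k k])
  let ?c = "1 + (\<Sum>i<k. d i)"
  show thesis
  proof
    show "?c > 0" using d by (intro add_pos_nonneg sum_nonneg) auto
    fix v :: "complex vec" assume v: "v \<in> carrier_vec k"
    have "d i \<le> ?c" if "i < k" for i
      using that d member_le_sum[of i "{..<k}" d] by auto
    then show "qform A v \<le> ?c * qform (1\<^sub>m k) v"
      unfolding A one_diag qform_unitary_diag[OF Uc(1) v] sum_distrib_left
      by (intro sum_mono) (auto intro: mult_right_mono)
  qed
qed

lemma pd_mat_add_smult_one:
  assumes A: "pd_mat k A" and c: "c \<ge> 0"
  shows "pd_mat k (A + complex_of_real c \<cdot>\<^sub>m 1\<^sub>m k)"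
proof -
  have "qform A v > 0 \<Longrightarrow> qform (A + complex_of_real c \<cdot>\<^sub>m 1\<^sub>m k) v > 0" if v: "v \<in> carrier_vec k" for v
    using A c v qform_one_nonneg[OF v]
    by (simp add: pd_mat_iff_qform hermitian_matD qform_add[of _ k] qform_smult[of _ k] add_pos_nonneg)
  then show ?thesis
    using A by (simp add: pd_mat_iff_qform hermitian_mat_add hermitian_mat_smult)
qed

lemma pd_mat_four_block_diag:
  assumes "pd_mat p A" "pd_mat q B"
  shows "pd_mat (p + q) (four_block_mat A (0\<^sub>m p q) (0\<^sub>m q p) B)"
proof -
  obtain U d where U: "unitary_mat p U" "A = unitary_diag p U d" "\<And>i. i < p \<Longrightarrow> 0 < d i"
    using pd_mat_spectral[OF assms(1)] by metis
  obtain V e where V: "unitary_mat q V" "B = unitary_diag q V e" "\<And>i. i < q \<Longrightarrow> 0 < e i"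
    using pd_mat_spectral[OF assms(2)] by metis
  show ?thesis
    using U V
    by (simp add: unitary_diag_four_block[OF unitary_matD(1)[OF U(1)] unitary_matD(1)[OF V(1)]]
        pd_mat_unitary_diag_iff[OF unitary_mat_four_block_diag[OF U(1) V(1)]])
qed

section \<open>The functional calculus\<close>

lemma rdiag_eigenvector:
  assumes w: "w \<in> carrier_vec k" and eigen: "rdiag k d *\<^sub>v w = c \<cdot>\<^sub>v w"
  shows "rdiag k (\<lambda>i. f (d i)) *\<^sub>v w = complex_of_real (f (Re c)) \<cdot>\<^sub>v w"
proof (rule eq_vecI)
  fix i assume "i < dim_vec (complex_of_real (f (Re c)) \<cdot>\<^sub>v w)"
  then have i: "i < k" using w by simp
  have "complex_of_real (d i) * w $ i = c * w $ i"
    using arg_cong[OF eigen, of "\<lambda>v. v $ i"] w i by (simp add: rdiag_mult_vec)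
  then have "w $ i = 0 \<or> d i = Re c" by auto
  then show "(rdiag k (\<lambda>i. f (d i)) *\<^sub>v w) $ i = (complex_of_real (f (Re c)) \<cdot>\<^sub>v w) $ i"
    using w i by (auto simp: rdiag_mult_vec)
qed (use w in simp)

lemma unitary_diag_eigenvector:
  assumes U: "unitary_mat k U" and v: "v \<in> carrier_vec k"
    and eigen: "unitary_diag k U d *\<^sub>v v = c \<cdot>\<^sub>v v"
  shows "unitary_diag k U (\<lambda>i. f (d i)) *\<^sub>v v = complex_of_real (f (Re c)) \<cdot>\<^sub>v v"
proof -
  note Uc = unitary_matD[OF U]
  define w where "w = mat_adjoint U *\<^sub>v v"
  have w: "w \<in> carrier_vec k" using Uc v by (simp add: w_def mult_mat_vec_carrier[of _ k k])
  have diag_mult_v: "unitary_diag k U g *\<^sub>v v = U *\<^sub>v (rdiag k g *\<^sub>v w)" for g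
    unfolding unitary_diag_def w_def using Uc v
    by (simp add: assoc_mult_mat_vec[of _ k k _ k] mult_carrier_mat[of _ k k]
        mult_mat_vec_carrier[of _ k k])
  have "rdiag k d *\<^sub>v w = (mat_adjoint U * U) *\<^sub>v (rdiag k d *\<^sub>v w)"
    using Uc by simp
  also have "\<dots> = mat_adjoint U *\<^sub>v (c \<cdot>\<^sub>v v)"
    unfolding eigen[symmetric] diag_mult_v using Uc w
    by (intro assoc_mult_mat_vec[of _ k k _ k]) auto
  also have "\<dots> = c \<cdot>\<^sub>v w"
    using Uc v by (simp add: w_def mult_mat_vec[of _ k k])
  finally have "rdiag k (\<lambda>i. f (d i)) *\<^sub>v w = complex_of_real (f (Re c)) \<cdot>\<^sub>v w"
    by (rule rdiag_eigenvector[OF w])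
  moreover have "U *\<^sub>v w = v"
    unfolding w_def using Uc v by (simp flip: assoc_mult_mat_vec[of _ k k _ k])
  ultimately show ?thesis
    using Uc w by (simp add: diag_mult_v mult_mat_vec[of _ k k])
qed

lemma mat_fun_unitary_diag:
  assumes U: "unitary_mat k U"
  shows "mat_fun k f (unitary_diag k U d) = unitary_diag k U (\<lambda>i. f (d i))"
proof -
  note Uc = unitary_matD(1)[OF U]
  define B where "B = mat_fun k f (unitary_diag k U d)"
  have "\<exists>B. B \<in> carrier_mat k k \<and> (\<forall>c v. eigenvector (unitary_diag k U d) v c \<longrightarrow>
      B *\<^sub>v v = complex_of_real (f (Re c)) \<cdot>\<^sub>v v)"
    using Uc unitary_diag_eigenvector[OF U]
    by (intro exI[of _ "unitary_diag k U (\<lambda>i. f (d i))"])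
      (auto simp: eigenvector_def carrier_matD[OF unitary_diag_carrier[OF Uc]])
  from someI_ex[OF this] have B: "B \<in> carrier_mat k k"
    and B_eigen: "\<And>c v. eigenvector (unitary_diag k U d) v c \<Longrightarrow> B *\<^sub>v v = complex_of_real (f (Re c)) \<cdot>\<^sub>v v"
    by (auto simp: B_def mat_fun_def)
  have "B * U = U * rdiag k (\<lambda>i. f (d i))"
  proof (rule mult_eq_mult_rdiagI[OF B Uc])
    fix i assume i: "i < k"
    have "eigenvector (unitary_diag k U d) (col U i) (complex_of_real (d i))"
      using unitary_diag_mult_col[OF U i] unitary_mat_col_neq_0[OF U i] Uc i
      by (auto simp: eigenvector_def carrier_matD[OF unitary_diag_carrier[OF Uc]])
    from B_eigen[OF this] show "B *\<^sub>v col U i = complex_of_real (f (d i)) \<cdot>\<^sub>v col U i" by simp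
  qed
  then show ?thesis
    unfolding B_def[symmetric] by (rule unitary_diag_eqI[OF U B])
qed

lemma mat_fun_rdiag: "mat_fun k f (rdiag k d) = rdiag k (\<lambda>i. f (d i))"
  using mat_fun_unitary_diag[OF unitary_mat_one, of k f d] by (simp add: unitary_diag_one)

lemma mat_fun_smult_one:
  "mat_fun k f (complex_of_real c \<cdot>\<^sub>m 1\<^sub>m k) = complex_of_real (f c) \<cdot>\<^sub>m 1\<^sub>m k"
  using mat_fun_rdiag[of k f "\<lambda>_. c"] by (simp add: rdiag_const)

lemma hermitian_mat_mat_fun:
  assumes "hermitian_mat k A"
  shows "hermitian_mat k (mat_fun k f A)"
proof -
  obtain U d where U: "unitary_mat k U" and A: "A = unitary_diag k U d"
    using hermitian_mat_spectral[OF assms] .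
  show ?thesis
    unfolding A mat_fun_unitary_diag[OF U]
    by (rule hermitian_mat_unitary_diag[OF unitary_matD(1)[OF U]])
qed

lemma mat_fun_four_block_diag:
  assumes "hermitian_mat p A" "hermitian_mat q B"
  shows "mat_fun (p + q) f (four_block_mat A (0\<^sub>m p q) (0\<^sub>m q p) B)
    = four_block_mat (mat_fun p f A) (0\<^sub>m p q) (0\<^sub>m q p) (mat_fun q f B)"
proof -
  obtain U d where U: "unitary_mat p U" "A = unitary_diag p U d"
    using hermitian_mat_spectral[OF assms(1)] .
  obtain V e where V: "unitary_mat q V" "B = unitary_diag q V e"
    using hermitian_mat_spectral[OF assms(2)] .
  show ?thesis
    using U V
    by (simp add: unitary_diag_four_block[OF unitary_matD(1)[OF U(1)] unitary_matD(1)[OF V(1)]]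
        mat_fun_unitary_diag unitary_mat_four_block_diag if_distrib[of f])
qed

lemma mat_fun_eigenvector:
  assumes A: "hermitian_mat k A" and v: "v \<in> carrier_vec k" and eigen: "A *\<^sub>v v = c \<cdot>\<^sub>v v"
  shows "mat_fun k f A *\<^sub>v v = complex_of_real (f (Re c)) \<cdot>\<^sub>v v"
proof -
  obtain U d where U: "unitary_mat k U" and AU: "A = unitary_diag k U d"
    using hermitian_mat_spectral[OF A] .
  show ?thesis
    using unitary_diag_eigenvector[OF U v] eigen unfolding AU mat_fun_unitary_diag[OF U] .
qed

lemma intertwine_eigenvector:
  fixes A B Z :: "complex mat"
  assumes carriers: "A \<in> carrier_mat p p" "B \<in> carrier_mat q q" "Z \<in> carrier_mat p q"
      "v \<in> carrier_vec q"
    and intertwine: "A * Z = Z * B" and eigen: "B *\<^sub>v v = c \<cdot>\<^sub>v v"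
  shows "A *\<^sub>v (Z *\<^sub>v v) = c \<cdot>\<^sub>v (Z *\<^sub>v v)"
proof -
  have "A *\<^sub>v (Z *\<^sub>v v) = (A * Z) *\<^sub>v v"
    using carriers by (intro assoc_mult_mat_vec[symmetric]) auto
  also have "\<dots> = Z *\<^sub>v (B *\<^sub>v v)"
    unfolding intertwine using carriers by (intro assoc_mult_mat_vec[of _ p q _ q]) auto
  also have "\<dots> = c \<cdot>\<^sub>v (Z *\<^sub>v v)"
    unfolding eigen using carriers by (intro mult_mat_vec[of _ p q]) auto
  finally show ?thesis .
qed

lemma mat_fun_intertwine:
  assumes A: "hermitian_mat p A" and B: "hermitian_mat q B" and Z: "Z \<in> carrier_mat p q"
    and intertwine: "A * Z = Z * B"
  shows "mat_fun p f A * Z = Z * mat_fun q f B"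
proof -
  obtain V e where V: "unitary_mat q V" and BV: "B = unitary_diag q V e"
    using hermitian_mat_spectral[OF B] .
  note Vc = unitary_matD[OF V]
  let ?fA = "mat_fun p f A" and ?fE = "rdiag q (\<lambda>j. f (e j))"
  have fA: "?fA \<in> carrier_mat p p"
    using hermitian_matD(1)[OF hermitian_mat_mat_fun[OF A]] .
  have ZV: "Z * V \<in> carrier_mat p q" using Z Vc by auto
  have "?fA * (Z * V) = Z * V * ?fE"
  proof (rule mult_eq_mult_rdiagI[OF fA ZV])
    fix j assume j: "j < q"
    have V_col: "col V j \<in> carrier_vec q" and col: "col (Z * V) j = Z *\<^sub>v col V j"
      using Vc j col_mult2[OF Z Vc(1) j] by auto
    have "B *\<^sub>v col V j = complex_of_real (e j) \<cdot>\<^sub>v col V j"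
      unfolding BV by (rule unitary_diag_mult_col[OF V j])
    then have "A *\<^sub>v (Z *\<^sub>v col V j) = complex_of_real (e j) \<cdot>\<^sub>v (Z *\<^sub>v col V j)"
      by (rule intertwine_eigenvector[OF hermitian_matD(1)[OF A] hermitian_matD(1)[OF B] Z V_col intertwine])
    then show "?fA *\<^sub>v col (Z * V) j = complex_of_real (f (e j)) \<cdot>\<^sub>v col (Z * V) j"
      using mat_fun_eigenvector[OF A mult_mat_vec_carrier[OF Z V_col]] unfolding col by fastforce
  qed
  then have "?fA * (Z * V) * mat_adjoint V = Z * mat_fun q f B"
    unfolding BV mat_fun_unitary_diag[OF V] using Z Vc
    by (simp add: unitary_diag_def assoc_mult_mat[of _ p q _ q _ q] assoc_mult_mat[of _ q q _ q _ q]
        mult_carrier_mat[of _ q q _ q])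
  moreover have "?fA * (Z * V) * mat_adjoint V = ?fA * Z * (V * mat_adjoint V)"
    using fA Z Vc
    by (simp add: assoc_mult_mat[of _ p q _ q _ q] assoc_mult_mat[of _ p p _ q _ q])
  ultimately show ?thesis using fA Z Vc by simp
qed

lemma mat_fun_isometry_compression:
  assumes Z: "Z \<in> carrier_mat p q" "mat_adjoint Z * Z = 1\<^sub>m q"
    and M: "hermitian_mat p M" and S: "hermitian_mat q S" and intertwine: "M * Z = Z * S"
  shows "mat_adjoint Z * mat_fun p f M * Z = mat_fun q f S"
proof -
  have Z': "mat_adjoint Z \<in> carrier_mat q p" using Z(1) by simp
  have fM: "mat_fun p f M \<in> carrier_mat p p" and fS: "mat_fun q f S \<in> carrier_mat q q"
    using M S by (auto intro: hermitian_matD(1)[OF hermitian_mat_mat_fun])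
  have "mat_adjoint Z * mat_fun p f M * Z = mat_adjoint Z * (Z * mat_fun q f S)"
    using Z(1) Z' fM mat_fun_intertwine[OF M S Z(1) intertwine, of f]
    by (simp add: assoc_mult_mat[of _ q p _ p _ q])
  also have "\<dots> = mat_adjoint Z * Z * mat_fun q f S"
    using Z Z' fS by (intro assoc_mult_mat[symmetric, of _ q p _ q _ q]) auto
  finally show ?thesis using Z(2) fS by simp
qed

section \<open>Hansen's inequality\<close>

lemma qform_isometry_complement:
  assumes Z: "Z \<in> carrier_mat p q" "mat_adjoint Z * Z = 1\<^sub>m q" and x: "x \<in> carrier_vec p"
  shows "qform (1\<^sub>m p - Z * mat_adjoint Z) x = qform (1\<^sub>m p) (x - Z *\<^sub>v (mat_adjoint Z *\<^sub>v x))"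
proof -
  define v where "v = mat_adjoint Z *\<^sub>v x"
  have v: "v \<in> carrier_vec q" using Z x by (simp add: v_def mult_mat_vec_carrier[of _ q p])
  have Zv: "Z *\<^sub>v v \<in> carrier_vec p" using Z v by auto
  have "Z * mat_adjoint Z = Z * 1\<^sub>m q * mat_adjoint Z" using Z by simp
  then have "qform (Z * mat_adjoint Z) x = qform (1\<^sub>m q) v"
    using qform_congruence_adjoint[of "1\<^sub>m q" q Z p x] Z x by (simp add: v_def)
  then have complement: "qform (1\<^sub>m p - Z * mat_adjoint Z) x = qform (1\<^sub>m p) x - qform (1\<^sub>m q) v"
    using Z x by (simp add: qform_minus[of _ p])
  have "qform (1\<^sub>m p) (Z *\<^sub>v v) = qform (1\<^sub>m q) v"
    using qform_congruence[of "1\<^sub>m p" p Z q v] Z v by simp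
  moreover have "(1\<^sub>m p *\<^sub>v x) \<bullet>c (Z *\<^sub>v v) = complex_of_real (qform (1\<^sub>m q) v)"
    using cscalar_prod_mat_adjoint[of "mat_adjoint Z" q p x v] Z x v hermitian_mat_qform[of q "1\<^sub>m q" v]
    by (simp add: v_def)
  moreover have "x - Z *\<^sub>v v = x + complex_of_real (- 1) \<cdot>\<^sub>v (Z *\<^sub>v v)"
    using Z x v by (intro eq_vecI) auto
  ultimately show ?thesis
    unfolding complement v_def[symmetric] using qform_add_smult[OF hermitian_mat_one x Zv, of "- 1"]
    by simp
qed

definition isometry_dilation :: "nat \<Rightarrow> complex mat \<Rightarrow> complex mat \<Rightarrow> real \<Rightarrow> complex mat" where
  "isometry_dilation p Z S c
    = Z * S * mat_adjoint Z + complex_of_real c \<cdot>\<^sub>m (1\<^sub>m p - Z * mat_adjoint Z)"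

lemma hermitian_mat_mult_adjoint:
  assumes "Z \<in> carrier_mat p q"
  shows "hermitian_mat p (Z * mat_adjoint Z)"
  using hermitian_mat_congruence_adjoint[OF hermitian_mat_one assms] assms by simp

lemma hermitian_mat_isometry_dilation:
  assumes "Z \<in> carrier_mat p q" "hermitian_mat q S"
  shows "hermitian_mat p (isometry_dilation p Z S c)"
  unfolding isometry_dilation_def using assms
  by (intro hermitian_mat_add hermitian_mat_smult hermitian_mat_minus hermitian_mat_congruence_adjoint
      hermitian_mat_mult_adjoint) auto

lemma qform_isometry_dilation:
  assumes Z: "Z \<in> carrier_mat p q" "mat_adjoint Z * Z = 1\<^sub>m q" and S: "hermitian_mat q S"
    and x: "x \<in> carrier_vec p"
  shows "qform (isometry_dilation p Z S c) x
    = qform S (mat_adjoint Z *\<^sub>v x) + c * qform (1\<^sub>m p) (x - Z *\<^sub>v (mat_adjoint Z *\<^sub>v x))"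
  unfolding isometry_dilation_def qform_isometry_complement[OF Z x, symmetric]
  using Z(1) S x qform_congruence_adjoint[of S q Z p x]
    hermitian_matD(1)[OF hermitian_mat_congruence_adjoint[OF S Z(1)]]
    hermitian_matD(1)[OF hermitian_mat_minus[OF hermitian_mat_one hermitian_mat_mult_adjoint[OF Z(1)]]]
  by (simp add: qform_add[of _ p] qform_smult[of _ p] hermitian_matD del: assoc_mult_mat)

lemma isometry_dilation_mult:
  assumes Z: "Z \<in> carrier_mat p q" "mat_adjoint Z * Z = 1\<^sub>m q" and S: "S \<in> carrier_mat q q"
  shows "isometry_dilation p Z S c * Z = Z * S"
proof -
  have Z': "mat_adjoint Z \<in> carrier_mat q p" using Z(1) by simp
  have "Z * S * mat_adjoint Z * Z = Z * S * (mat_adjoint Z * Z)"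
    using Z Z' S by (intro assoc_mult_mat[of _ p q _ p _ q]) auto
  moreover have "(1\<^sub>m p - Z * mat_adjoint Z) * Z = 0\<^sub>m p q"
    using Z Z' assoc_mult_mat[of Z p q "mat_adjoint Z" p Z q]
    by (simp add: minus_mult_distrib_mat[of _ p p])
  ultimately show ?thesis
    unfolding isometry_dilation_def using Z Z' S mult_carrier_mat[OF mult_carrier_mat[OF Z(1) S] Z']
    by (simp add: add_mult_distrib_mat[of _ p p] mult_smult_assoc_mat[of _ p p] minus_carrier_mat
        right_mult_one_mat[of _ p q] del: assoc_mult_mat)
qed

text \<open>The cross terms of \<open>A\<close> between the range of \<open>Z\<close> and its orthogonal complement are absorbed by
  Young's inequality, at the price of the margin \<open>h\<close> and of a large constant on the complement.\<close>

lemma mat_le_isometry_dilation: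
  assumes Z: "Z \<in> carrier_mat p q" "mat_adjoint Z * Z = 1\<^sub>m q"
    and A: "psd_mat p A" and B: "psd_mat q B"
    and compression_le: "mat_le q (mat_adjoint Z * A * Z) B" and h: "h > 0"
  obtains c where "mat_le p A (isometry_dilation p Z (B + complex_of_real h \<cdot>\<^sub>m 1\<^sub>m q) c)"
proof -
  obtain a where a: "\<And>v. v \<in> carrier_vec p \<Longrightarrow> qform A v \<le> a * qform (1\<^sub>m p) v"
    using psd_mat_qform_le_smult_one[OF A] by metis
  obtain b where b: "b > 0" "\<And>v. v \<in> carrier_vec q \<Longrightarrow> qform B v \<le> b * qform (1\<^sub>m q) v"
    using psd_mat_qform_le_smult_one[OF B] by metis
  define e where "e = h / b"
  define c where "c = (1 + 1 / e) * a"
  define S where "S = B + complex_of_real h \<cdot>\<^sub>m 1\<^sub>m q"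
  have e: "e > 0" "e * b = h" using h b(1) by (auto simp: e_def)
  have S: "hermitian_mat q S"
    unfolding S_def using B
    by (intro hermitian_mat_add hermitian_mat_smult) (auto simp: psd_mat_iff_qform)
  have "qform A x \<le> qform (isometry_dilation p Z S c) x" if x: "x \<in> carrier_vec p" for x
  proof -
    define v where "v = mat_adjoint Z *\<^sub>v x"
    define y where "y = x - Z *\<^sub>v v"
    have v: "v \<in> carrier_vec q" using Z x by (simp add: v_def mult_mat_vec_carrier[of _ q p])
    have y: "y \<in> carrier_vec p" using Z(1) x v by (simp add: y_def)
    have "qform A x \<le> (1 + e) * qform (mat_adjoint Z * A * Z) v + (1 + 1 / e) * qform A y"
      unfolding v_def y_def by (rule qform_le_young_range_split[OF A Z(1) x e(1)])
    also have "qform (mat_adjoint Z * A * Z) v \<le> qform B v"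
      by (rule mat_leD[OF compression_le v])
    also have "(1 + e) * qform B v \<le> qform S v"
      using mult_left_mono[OF b(2)[OF v], of e] e psd_mat_carrier[OF B] v
      by (simp add: S_def qform_add[of _ q] qform_smult[of _ q] distrib_right mult.assoc[symmetric])
    also have "(1 + 1 / e) * qform A y \<le> c * qform (1\<^sub>m p) y"
      unfolding c_def mult.assoc using a[OF y] e(1) by (intro mult_left_mono) auto
    also have "qform S v + c * qform (1\<^sub>m p) y = qform (isometry_dilation p Z S c) x"
      unfolding v_def y_def by (rule qform_isometry_dilation[OF Z S x, symmetric])
    finally show ?thesis using e(1) by simp
  qed
  then have "mat_le p A (isometry_dilation p Z S c)"
    using A hermitian_mat_isometry_dilation[OF Z(1) S] by (simp add: mat_le_iff_qform psd_mat_iff_qform)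
  then show thesis using that unfolding S_def by blast
qed

lemma op_monotone_isometry:
  assumes f: "op_monotone f" and Z: "Z \<in> carrier_mat p q" "mat_adjoint Z * Z = 1\<^sub>m q"
    and A: "pd_mat p A" and B: "pd_mat q B"
    and compression_le: "mat_le q (mat_adjoint Z * A * Z) B" and h: "h > 0"
  shows "mat_le q (mat_adjoint Z * mat_fun p f A * Z) (mat_fun q f (B + complex_of_real h \<cdot>\<^sub>m 1\<^sub>m q))"
proof -
  define S where "S = B + complex_of_real h \<cdot>\<^sub>m 1\<^sub>m q"
  obtain c where c: "mat_le p A (isometry_dilation p Z S c)"
    using mat_le_isometry_dilation[OF Z pd_mat_imp_psd_mat[OF A] pd_mat_imp_psd_mat[OF B] compression_le h]
    unfolding S_def .
  define M where "M = isometry_dilation p Z S c"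
  have S: "hermitian_mat q S"
    using pd_mat_add_smult_one[OF B, of h] h by (simp add: S_def pd_mat_iff_qform)
  have pdM: "pd_mat p M" unfolding M_def by (rule pd_mat_mono[OF A c])
  then have "mat_le p (mat_fun p f A) (mat_fun p f M)"
    using f A c unfolding op_monotone_def M_def by blast
  then have "mat_le q (mat_adjoint Z * mat_fun p f A * Z) (mat_adjoint Z * mat_fun p f M * Z)"
    using Z(1) by (rule mat_le_congruence)
  moreover have "mat_adjoint Z * mat_fun p f M * Z = mat_fun q f S"
    using pdM isometry_dilation_mult[OF Z hermitian_matD(1)[OF S]] unfolding M_def
    by (intro mat_fun_isometry_compression[OF Z _ S]) (auto simp: pd_mat_iff_qform)
  ultimately show ?thesis by (simp add: S_def)
qed

lemma contraction_isometry_completion: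
  assumes W: "W \<in> carrier_mat p q" and contraction: "mat_le q (mat_adjoint W * W) (1\<^sub>m q)"
  obtains N where "N \<in> carrier_mat q q" "mat_le q (mat_adjoint N * N) (1\<^sub>m q)"
    "mat_adjoint (W @\<^sub>r N) * (W @\<^sub>r N) = 1\<^sub>m q"
proof -
  have W': "mat_adjoint W \<in> carrier_mat q p" using W by simp
  have "psd_mat q (1\<^sub>m q - mat_adjoint W * W)" using contraction by (simp add: mat_le_def)
  then obtain N where N: "N \<in> carrier_mat q q"
    and defect: "1\<^sub>m q - mat_adjoint W * W = mat_adjoint N * N"
    by (rule psd_mat_factorization)
  have defect_sum: "mat_adjoint W * W + mat_adjoint N * N = 1\<^sub>m q"
    unfolding defect[symmetric] using W by (intro eq_matI) auto
  have "mat_adjoint (W @\<^sub>r N) * (W @\<^sub>r N) = mat_adjoint W * W + mat_adjoint N * N"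
    using append_rows_congruence[OF W N one_carrier_mat one_carrier_mat] W N W'
      carrier_append_rows[OF W N] by simp
  moreover have "1\<^sub>m q - mat_adjoint N * N = mat_adjoint W * W"
    unfolding defect_sum[symmetric] using W N by (intro eq_matI) auto
  ultimately show thesis
    using N W defect_sum by (intro that[of N]) (auto simp: mat_le_def psd_mat_adjoint_mult)
qed

lemma op_monotone_contraction:
  assumes f: "op_monotone f" "\<And>x. x > 0 \<Longrightarrow> f x \<ge> 0"
    and W: "W \<in> carrier_mat p q" and contraction: "mat_le q (mat_adjoint W * W) (1\<^sub>m q)"
    and A: "pd_mat p A" and B: "pd_mat q B"
    and compression_le: "mat_le q (mat_adjoint W * A * W) B" and h: "h > 0"
  shows "mat_le q (mat_adjoint W * mat_fun p f A * W) (mat_fun q f (B + complex_of_real h \<cdot>\<^sub>m 1\<^sub>m q))"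
proof -
  let ?D = "\<lambda>c. complex_of_real c \<cdot>\<^sub>m (1\<^sub>m q :: complex mat)"
  obtain N where N: "N \<in> carrier_mat q q" and N_contraction: "mat_le q (mat_adjoint N * N) (1\<^sub>m q)"
    and isometry: "mat_adjoint (W @\<^sub>r N) * (W @\<^sub>r N) = 1\<^sub>m q"
    using contraction_isometry_completion[OF W contraction] .
  define Z where "Z = W @\<^sub>r N"
  define \<delta> where "\<delta> = h / 2"
  have \<delta>: "\<delta> > 0" using h by (simp add: \<delta>_def)
  define T where "T = four_block_mat A (0\<^sub>m p q) (0\<^sub>m q p) (?D \<delta>)"
  have Z: "Z \<in> carrier_mat (p + q) q" unfolding Z_def using W N by (rule carrier_append_rows)
  have A_hermitian: "hermitian_mat p A" using A by (simp add: pd_mat_iff_qform)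
  note fA = hermitian_matD(1)[OF hermitian_mat_mat_fun[OF A_hermitian], of f]
  note congruence = append_rows_congruence_smult_one[OF W N, folded Z_def]
  have "mat_le q (mat_adjoint Z * T * Z) (B + ?D \<delta>)"
    unfolding T_def congruence[OF hermitian_matD(1)[OF A_hermitian]]
    using N_contraction \<delta> by (intro mat_le_add[OF compression_le] mat_le_smult) auto
  then have "mat_le q (mat_adjoint Z * mat_fun (p + q) f T * Z) (mat_fun q f (B + ?D \<delta> + ?D \<delta>))"
    using f(1) Z isometry A B \<delta> unfolding T_def Z_def
    by (intro op_monotone_isometry pd_mat_four_block_diag pd_mat_add_smult_one pd_mat_smult_one) auto
  moreover have "mat_adjoint Z * mat_fun (p + q) f T * Z
      = mat_adjoint W * mat_fun p f A * W + complex_of_real (f \<delta>) \<cdot>\<^sub>m (mat_adjoint N * N)"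
    unfolding T_def
    by (simp only: congruence[OF fA] mat_fun_smult_one
        mat_fun_four_block_diag[OF A_hermitian hermitian_mat_smult[OF hermitian_mat_one]])
  moreover have "mat_le q (mat_adjoint W * mat_fun p f A * W)
      (mat_adjoint W * mat_fun p f A * W + complex_of_real (f \<delta>) \<cdot>\<^sub>m (mat_adjoint N * N))"
    using f(2) \<delta> N
    by (intro mat_le_add_psd_mat congruence_carrier[OF fA W] psd_mat_smult psd_mat_adjoint_mult) auto
  moreover have "B + ?D \<delta> + ?D \<delta> = B + ?D h"
    using B by (intro eq_matI) (auto simp: pd_mat_def \<delta>_def)
  ultimately show ?thesis by (metis mat_le_trans)
qed

lemma op_monotone_imp_mono:
  assumes f: "op_monotone f" and "0 < x" "x \<le> y"
  shows "f x \<le> f y"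
proof -
  have "mat_le 1 (mat_fun 1 f (rdiag 1 (\<lambda>_. x))) (mat_fun 1 f (rdiag 1 (\<lambda>_. y)))"
    using assms(2,3)
    by (intro f[unfolded op_monotone_def, rule_format]) (auto simp: pd_mat_rdiag_iff mat_le_rdiag_iff)
  then show ?thesis by (simp add: mat_fun_rdiag mat_le_rdiag_iff)
qed

lemma midpoint_congruence:
  obtains W :: "complex mat" where "W \<in> carrier_mat 2 1"
    "\<And>g. mat_adjoint W * rdiag 2 g * W = rdiag 1 (\<lambda>_. (g 0 + g 1) / 2)"
proof
  define W :: "complex mat" where "W = mat 2 1 (\<lambda>_. complex_of_real (sqrt (1 / 2)))"
  show W: "W \<in> carrier_mat 2 1" by (simp add: W_def)
  show "mat_adjoint W * rdiag 2 g * W = rdiag 1 (\<lambda>_. (g 0 + g 1) / 2)" for g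
  proof (rule eq_matI)
    fix i j
    assume "i < dim_row (rdiag 1 (\<lambda>_. (g 0 + g 1) / 2))" "j < dim_col (rdiag 1 (\<lambda>_. (g 0 + g 1) / 2))"
    then have ij: "i = 0" "j = 0" by auto
    have col: "col W 0 \<in> carrier_vec 2" by (simp add: W_def)
    have "(mat_adjoint W * rdiag 2 g * W) $$ (0, 0) = complex_of_real (qform (rdiag 2 g) (col W 0))"
      unfolding hermitian_mat_qform[OF hermitian_mat_rdiag col, symmetric]
      using W by (intro cscalar_prod_mult_col[of _ 2 2]) auto
    also have "qform (rdiag 2 g) (col W 0) = (\<Sum>i<2. g i * (1 / 2))"
      unfolding qform_rdiag[OF col] by (rule sum.cong) (auto simp: W_def norm_divide power_divide)
    also have "\<dots> = (g 0 + g 1) / 2"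
      by (simp add: numeral_2_eq_2 add_divide_distrib)
    finally show "(mat_adjoint W * rdiag 2 g * W) $$ (i, j) = rdiag 1 (\<lambda>_. (g 0 + g 1) / 2) $$ (i, j)"
      unfolding ij by simp
  qed (use W in auto)
qed

lemma op_monotone_midpoint:
  assumes f: "op_monotone f" "\<And>x. x > 0 \<Longrightarrow> f x \<ge> 0" and "0 < x" "0 < y" "(x + y) / 2 < z"
  shows "f x + f y \<le> 2 * f z"
proof -
  obtain W :: "complex mat" where W: "W \<in> carrier_mat 2 1"
    and W_congruence: "\<And>g. mat_adjoint W * rdiag 2 g * W = rdiag 1 (\<lambda>_. (g 0 + g 1) / 2)"
    using midpoint_congruence by metis
  define d where "d i = (if i = 0 then x else y)" for i :: nat
  define c where "c = (x + y) / 2"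
  have c: "c > 0" "c < z" using assms by (auto simp: c_def)
  have "mat_adjoint W * W = 1\<^sub>m 1"
    using W_congruence[of "\<lambda>_. 1"] W by simp
  then have contraction: "mat_le 1 (mat_adjoint W * W) (1\<^sub>m 1)"
    using mat_le_refl[OF hermitian_mat_one] by simp
  have compression_le: "mat_le 1 (mat_adjoint W * rdiag 2 d * W) (rdiag 1 (\<lambda>_. c))"
    unfolding W_congruence mat_le_rdiag_iff by (simp add: d_def c_def)
  have "mat_le 1 (mat_adjoint W * mat_fun 2 f (rdiag 2 d) * W)
      (mat_fun 1 f (rdiag 1 (\<lambda>_. c) + complex_of_real (z - c) \<cdot>\<^sub>m 1\<^sub>m 1))"
    using assms(3,4) c
    by (intro op_monotone_contraction f W contraction compression_le)
      (auto simp: pd_mat_rdiag_iff d_def)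
  also have "rdiag 1 (\<lambda>_. c) + complex_of_real (z - c) \<cdot>\<^sub>m 1\<^sub>m 1 = rdiag 1 (\<lambda>_. z)"
    by (rule eq_matI) auto
  finally show ?thesis
    unfolding mat_fun_rdiag W_congruence mat_le_rdiag_iff by (simp add: d_def)
qed

text \<open>The midpoint inequality at \<open>s - 4h\<close> and \<open>s + h\<close> bounds \<open>f (s + h)\<close> by
  \<open>2 f (s - h) - f (s - 4h)\<close>, and both values approach \<open>sup {f y | y < s} \<le> f s\<close>.\<close>

lemma mono_midpoint_right_continuous:
  fixes f :: "real \<Rightarrow> real"
  assumes mono: "\<And>x y. 0 < x \<Longrightarrow> x \<le> y \<Longrightarrow> f x \<le> f y"
    and midpoint: "\<And>x y z. 0 < x \<Longrightarrow> 0 < y \<Longrightarrow> (x + y) / 2 < z \<Longrightarrow> f x + f y \<le> 2 * f z"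
    and s: "0 < s" and e: "0 < e"
  obtains h where "h > 0" "f (s + h) < f s + e"
proof -
  define l where "l = (SUP y\<in>{0<..<s}. f y)"
  have bdd: "bdd_above (f ` {0<..<s})"
    using mono by (intro bdd_aboveI[of _ "f s"]) auto
  have nonempty: "{0<..<s} \<noteq> {}" using s by simp
  have le_l: "f y \<le> l" if "0 < y" "y < s" for y
    unfolding l_def using that by (intro cSUP_upper bdd) auto
  have "l \<le> f s"
    unfolding l_def using mono by (intro cSUP_least nonempty) auto
  have "l - e < l" using e by simp
  then obtain y where y: "0 < y" "y < s" "l - e < f y"
    unfolding l_def using less_cSUP_iff[OF nonempty bdd] by auto
  define h where "h = (s - y) / 4"
  have "h > 0" using y by (simp add: h_def)
  have "f y + f (s + h) \<le> 2 * f (s - h)"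
    using y by (intro midpoint) (auto simp: h_def field_simps)
  moreover have "f (s - h) \<le> l" using y by (intro le_l) (auto simp: h_def field_simps)
  ultimately have "f (s + h) < f s + e" using y(3) \<open>l \<le> f s\<close> by linarith
  with \<open>h > 0\<close> show thesis by (rule that)
qed

lemma op_monotone_right_continuous:
  fixes d :: "nat \<Rightarrow> real"
  assumes f: "op_monotone f" "\<And>x. x > 0 \<Longrightarrow> f x \<ge> 0"
    and d: "\<And>i. i < k \<Longrightarrow> 0 < d i" and e: "0 < e"
  obtains h where "h > 0" "\<And>i. i < k \<Longrightarrow> f (d i + h) \<le> f (d i) + e"
proof -
  have "\<exists>h>0. f (d i + h) < f (d i) + e" if "i < k" for i
    by (rule mono_midpoint_right_continuous[of f "d i" e])
      (use op_monotone_imp_mono[OF f(1)] op_monotone_midpoint[OF f] d[OF that] e in blast)+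
  then obtain g where g: "\<And>i. i < k \<Longrightarrow> g i > 0 \<and> f (d i + g i) < f (d i) + e" by metis
  define h where "h = Min (insert 1 (g ` {..<k}))"
  show thesis
  proof
    show "h > 0" unfolding h_def using g by (subst Min_gr_iff) auto
    fix i assume i: "i < k"
    then have "h \<le> g i" unfolding h_def by (intro Min_le) auto
    then have "f (d i + h) \<le> f (d i + g i)"
      using \<open>h > 0\<close> d[OF i] by (intro op_monotone_imp_mono[OF f(1)]) auto
    then show "f (d i + h) \<le> f (d i) + e" using g[OF i] by linarith
  qed
qed

lemma op_monotone_mat_fun_right_continuous:
  assumes f: "op_monotone f" "\<And>x. x > 0 \<Longrightarrow> f x \<ge> 0" and B: "pd_mat k B" and e: "0 < e"
  obtains h where "h > 0" "\<And>v. v \<in> carrier_vec k \<Longrightarrow>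
    qform (mat_fun k f (B + complex_of_real h \<cdot>\<^sub>m 1\<^sub>m k)) v
      \<le> qform (mat_fun k f B) v + e * qform (1\<^sub>m k) v"
proof -
  obtain U d where U: "unitary_mat k U" and B: "B = unitary_diag k U d" and d: "\<And>i. i < k \<Longrightarrow> 0 < d i"
    using pd_mat_spectral[OF B] by metis
  note Uc = unitary_matD(1)[OF U]
  obtain h where h: "h > 0" and step: "\<And>i. i < k \<Longrightarrow> f (d i + h) \<le> f (d i) + e"
    using op_monotone_right_continuous[of f k d e, OF f d e] by metis
  have "qform (mat_fun k f (B + complex_of_real h \<cdot>\<^sub>m 1\<^sub>m k)) v
      \<le> qform (mat_fun k f B) v + e * qform (1\<^sub>m k) v"
    if v: "v \<in> carrier_vec k" for v
  proof -
    have "qform (mat_fun k f (B + complex_of_real h \<cdot>\<^sub>m 1\<^sub>m k)) v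
        = qform (unitary_diag k U (\<lambda>i. f (d i + h))) v"
      unfolding B unitary_diag_add_smult_one[OF U] mat_fun_unitary_diag[OF U] ..
    also have "\<dots> \<le> qform (unitary_diag k U (\<lambda>i. f (d i) + e)) v"
      unfolding qform_unitary_diag[OF Uc v] using step by (intro sum_mono mult_right_mono) auto
    also have "\<dots> = qform (mat_fun k f B) v + e * qform (1\<^sub>m k) v"
      unfolding B mat_fun_unitary_diag[OF U] unitary_diag_add_smult_one[OF U, symmetric]
      using Uc v by (simp add: qform_add[of _ k] qform_smult[of _ k])
    finally show ?thesis .
  qed
  with h show thesis by (rule that)
qed

theorem hansen_inequality:
  assumes f: "op_monotone f" "\<And>x. x > 0 \<Longrightarrow> f x \<ge> 0"
    and W: "W \<in> carrier_mat p q" and contraction: "mat_le q (mat_adjoint W * W) (1\<^sub>m q)"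
    and A: "pd_mat p A" and B: "pd_mat q B" and compression_le: "mat_le q (mat_adjoint W * A * W) B"
  shows "mat_le q (mat_adjoint W * mat_fun p f A * W) (mat_fun q f B)"
proof -
  have "qform (mat_adjoint W * mat_fun p f A * W) v \<le> qform (mat_fun q f B) v"
    if v: "v \<in> carrier_vec q" for v
  proof (rule field_le_epsilon)
    fix e :: real assume e: "e > 0"
    define \<delta> where "\<delta> = e / (1 + qform (1\<^sub>m q) v)"
    have \<delta>: "\<delta> > 0" "\<delta> * qform (1\<^sub>m q) v \<le> e"
      using e qform_one_nonneg[OF v] by (auto simp: \<delta>_def field_simps)
    obtain h where h: "h > 0" and step: "qform (mat_fun q f (B + complex_of_real h \<cdot>\<^sub>m 1\<^sub>m q)) v
        \<le> qform (mat_fun q f B) v + \<delta> * qform (1\<^sub>m q) v"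
      using op_monotone_mat_fun_right_continuous[OF f B \<delta>(1)] v by metis
    have "qform (mat_adjoint W * mat_fun p f A * W) v
        \<le> qform (mat_fun q f (B + complex_of_real h \<cdot>\<^sub>m 1\<^sub>m q)) v"
      using op_monotone_contraction[OF f W contraction A B compression_le h] v by (rule mat_leD)
    also note step
    finally show "qform (mat_adjoint W * mat_fun p f A * W) v \<le> qform (mat_fun q f B) v + e"
      using \<delta>(2) by simp
  qed
  then show ?thesis
    using A B W by (subst mat_le_iff_qform)
      (auto simp: pd_mat_iff_qform hermitian_mat_mat_fun intro!: hermitian_mat_congruence[OF _ W])
qed

lemma hansen_inequality_weighted:
  assumes f: "op_monotone f" "\<And>x. x > 0 \<Longrightarrow> f x \<ge> 0" and V: "V \<in> carrier_mat p q"
    and \<mu>: "\<And>i. i < p \<Longrightarrow> \<mu> i > 0" and \<kappa>: "\<And>i. i < p \<Longrightarrow> \<kappa> i > 0" and B: "pd_mat q B"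
    and le_\<mu>: "mat_le q (mat_adjoint V * rdiag p \<mu> * V) (1\<^sub>m q)"
    and le_\<kappa>: "mat_le q (mat_adjoint V * rdiag p \<kappa> * V) B"
  shows "mat_le q (mat_adjoint V * rdiag p (\<lambda>i. f (\<kappa> i / \<mu> i) * \<mu> i) * V) (mat_fun q f B)"
proof -
  let ?S = "rdiag p (\<lambda>i. sqrt (\<mu> i))" and ?A = "rdiag p (\<lambda>i. \<kappa> i / \<mu> i)"
  define W where "W = ?S * V"
  have W: "W \<in> carrier_mat p q" unfolding W_def using V by (intro mult_carrier_mat) auto
  have W_congruence: "mat_adjoint W * rdiag p g * W = mat_adjoint V * rdiag p (\<lambda>i. g i * \<mu> i) * V" for g
  proof -
    have "?S * rdiag p g * ?S = rdiag p (\<lambda>i. g i * \<mu> i)"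
      unfolding rdiag_mult_rdiag using \<mu> by (intro rdiag_cong) (simp add: order_less_imp_le)
    then show ?thesis
      using congruence_mult[of "rdiag p g" p ?S p V q] V by (simp add: W_def)
  qed
  have "rdiag p (\<lambda>i. \<kappa> i / \<mu> i * \<mu> i) = rdiag p \<kappa>"
    using \<mu> by (intro rdiag_cong) (metis less_numeral_extra(3) nonzero_divide_eq_eq)
  then have "mat_le q (mat_adjoint W * ?A * W) B"
    unfolding W_congruence using le_\<kappa> by simp
  moreover have "mat_le q (mat_adjoint W * W) (1\<^sub>m q)"
    using W_congruence[of "\<lambda>_. 1"] W le_\<mu> by simp
  ultimately have "mat_le q (mat_adjoint W * mat_fun p f ?A * W) (mat_fun q f B)"
    using \<mu> \<kappa> by (intro hansen_inequality f W B) (auto simp: pd_mat_rdiag_iff)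
  then show ?thesis unfolding mat_fun_rdiag W_congruence .
qed

lemma congruence_rdiag_col_eq_0:
  assumes V: "V \<in> carrier_mat p q" and \<mu>: "\<And>i. i < p \<Longrightarrow> \<mu> i > 0"
    and le_\<mu>: "mat_le q (mat_adjoint V * rdiag p \<mu> * V) (rdiag q c)" and j: "j < q" "c j \<le> 0"
  shows "col V j = 0\<^sub>v p"
proof (rule ccontr)
  assume "col V j \<noteq> 0\<^sub>v p"
  moreover have "pd_mat p (rdiag p \<mu>)" using \<mu> by (simp add: pd_mat_rdiag_iff)
  ultimately have "0 < qform (rdiag p \<mu>) (col V j)"
    using V j by (simp add: pd_mat_iff_qform)
  also have "\<dots> = qform (mat_adjoint V * rdiag p \<mu> * V) (unit_vec q j)"
    using V j by (subst qform_congruence) (auto simp: mult_mat_vec_unit_vec)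
  also have "\<dots> \<le> qform (rdiag q c) (unit_vec q j)" using le_\<mu> by (rule mat_leD) simp
  also have "\<dots> = c j"
    using qform_unitary_diag_col[OF unitary_mat_one j(1), of c] j(1) by (simp add: unitary_diag_one)
  finally show False using j(2) by simp
qed

lemma mult_rdiag_eq_self_if_congruence_le:
  assumes V: "V \<in> carrier_mat p q"
    and \<mu>: "\<And>i. i < p \<Longrightarrow> \<mu> i > 0" and \<kappa>: "\<And>i. i < p \<Longrightarrow> \<kappa> i > 0"
    and le_\<mu>: "mat_le q (mat_adjoint V * rdiag p \<mu> * V) (rdiag q c)"
    and le_\<kappa>: "mat_le q (mat_adjoint V * rdiag p \<kappa> * V) (rdiag q d)"
    and r: "\<And>j. j < q \<Longrightarrow> 0 < c j \<Longrightarrow> 0 < d j \<Longrightarrow> r j = 1"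
  shows "V * rdiag q r = V"
proof (rule mult_rdiag_eq_self[OF V])
  fix j assume j: "j < q" and "r j \<noteq> 1"
  then have "c j \<le> 0 \<or> d j \<le> 0" using r[OF j] by linarith
  then show "col V j = 0\<^sub>v p"
    using congruence_rdiag_col_eq_0[OF V \<mu> le_\<mu> j] congruence_rdiag_col_eq_0[OF V \<kappa> le_\<kappa> j] by blast
qed

text \<open>Where \<open>c j = 0\<close> or \<open>d j = 0\<close> the column \<open>j\<close> of \<open>V\<close> vanishes, and so does the right-hand entry,
  since \<open>x / 0 = 0\<close> and \<open>f 0 = 0\<close>. On the remaining columns \<open>V\<close> is rescaled by \<open>1 / sqrt (c j)\<close>.\<close>

theorem hansen_perspective_inequality:
  assumes f: "op_monotone f" "\<And>x. x > 0 \<Longrightarrow> f x \<ge> 0" "f 0 = 0"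
    and V: "V \<in> carrier_mat p q"
    and \<mu>: "\<And>i. i < p \<Longrightarrow> \<mu> i > 0" and \<kappa>: "\<And>i. i < p \<Longrightarrow> \<kappa> i > 0"
    and c: "\<And>j. j < q \<Longrightarrow> c j \<ge> 0" and d: "\<And>j. j < q \<Longrightarrow> d j \<ge> 0"
    and le_\<mu>: "mat_le q (mat_adjoint V * rdiag p \<mu> * V) (rdiag q c)"
    and le_\<kappa>: "mat_le q (mat_adjoint V * rdiag p \<kappa> * V) (rdiag q d)"
  shows "mat_le q (mat_adjoint V * rdiag p (\<lambda>i. f (\<kappa> i / \<mu> i) * \<mu> i) * V)
    (rdiag q (\<lambda>j. f (d j / c j) * c j))"
proof -
  define good where "good j \<longleftrightarrow> c j > 0 \<and> d j > 0" for j
  define s where "s j = (if good j then d j / c j else 1)" for j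
  define R where "R = rdiag q (\<lambda>j. if good j then 1 / sqrt (c j) else 0)"
  define T where "T = rdiag q (\<lambda>j. if good j then sqrt (c j) else 0)"
  have R: "R \<in> carrier_mat q q" "mat_adjoint R = R" and T: "T \<in> carrier_mat q q"
    by (auto simp: R_def T_def)
  have VR: "V * R \<in> carrier_mat p q" using V R(1) by simp
  have "V * (R * T) = V"
    unfolding R_def T_def rdiag_mult_rdiag
    by (intro mult_rdiag_eq_self_if_congruence_le[OF V \<mu> \<kappa> le_\<mu> le_\<kappa>]) (auto simp: good_def)
  then have VRT: "V * R * T = V"
    using V R(1) T by (simp add: assoc_mult_mat[of _ p q _ q _ q])
  note le_R = mat_le_congruence_mult[OF _ rdiag_carrier V R(1), unfolded R(2)]
  have "mat_le q (R * rdiag q c * R) (rdiag q (\<lambda>_. 1))" "mat_le q (R * rdiag q d * R) (rdiag q s)"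
    unfolding R_def rdiag_mult_rdiag mat_le_rdiag_iff by (auto simp: good_def s_def)
  then have rescaled_le: "mat_le q (mat_adjoint (V * R) * rdiag p \<mu> * (V * R)) (1\<^sub>m q)"
    "mat_le q (mat_adjoint (V * R) * rdiag p \<kappa> * (V * R)) (rdiag q s)"
    using mat_le_trans[OF le_R[OF le_\<mu>]] mat_le_trans[OF le_R[OF le_\<kappa>]] by simp_all
  have "mat_le q (mat_adjoint (V * R) * rdiag p (\<lambda>i. f (\<kappa> i / \<mu> i) * \<mu> i) * (V * R))
      (mat_fun q f (rdiag q s))"
    by (intro hansen_inequality_weighted f(1,2) VR \<mu> \<kappa> rescaled_le)
      (auto simp: pd_mat_rdiag_iff s_def good_def)
  then have "mat_le q (mat_adjoint V * rdiag p (\<lambda>i. f (\<kappa> i / \<mu> i) * \<mu> i) * V)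
      (mat_adjoint T * rdiag q (\<lambda>j. f (s j)) * T)"
    using mat_le_congruence_mult[OF _ rdiag_carrier VR T] unfolding VRT mat_fun_rdiag by blast
  also have "mat_adjoint T * rdiag q (\<lambda>j. f (s j)) * T = rdiag q (\<lambda>j. f (d j / c j) * c j)"
    unfolding T_def mat_adjoint_rdiag rdiag_mult_rdiag using c d f(3)
    by (intro rdiag_cong) (auto simp: s_def good_def order_less_le)
  finally show ?thesis .
qed

section \<open>Orthonormal bases of the Hilbert-Schmidt space\<close>

lemma lin_mapD:
  assumes "lin_map n m T"
  shows "A \<in> carrier_mat n n \<Longrightarrow> T A \<in> carrier_mat m m"
    and "A \<in> carrier_mat n n \<Longrightarrow> B \<in> carrier_mat n n \<Longrightarrow> T (A + B) = T A + T B"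
    and "A \<in> carrier_mat n n \<Longrightarrow> T (c \<cdot>\<^sub>m A) = c \<cdot>\<^sub>m T A"
  using assms by (simp_all add: lin_map_def)

lemma mtrace_mult_commute:
  assumes "A \<in> carrier_mat n m" "B \<in> carrier_mat m n"
  shows "mtrace (A * B) = mtrace (B * A)"
proof -
  have "mtrace (A * B) = (\<Sum>i<n. \<Sum>j<m. A $$ (i, j) * B $$ (j, i))"
    using assms by (simp add: mtrace_def scalar_prod_def lessThan_atLeast0)
  also have "\<dots> = (\<Sum>j<m. \<Sum>i<n. A $$ (i, j) * B $$ (j, i))" by (rule sum.swap)
  also have "\<dots> = mtrace (B * A)"
    using assms by (simp add: mtrace_def scalar_prod_def lessThan_atLeast0 mult.commute)
  finally show ?thesis .
qed

lemma hs_inner_sum: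
  assumes "A \<in> carrier_mat k k" "B \<in> carrier_mat k k"
  shows "hs_inner A B = (\<Sum>j<k. \<Sum>i<k. cnj (A $$ (i, j)) * B $$ (i, j))"
  using assms by (simp add: hs_inner_def mtrace_def scalar_prod_def lessThan_atLeast0)

lemma hs_inner_commute:
  assumes "A \<in> carrier_mat k k" "B \<in> carrier_mat k k"
  shows "hs_inner B A = cnj (hs_inner A B)"
  using assms by (simp add: hs_inner_sum mult.commute)

lemma hs_inner_add_right:
  assumes "A \<in> carrier_mat k k" "B \<in> carrier_mat k k" "C \<in> carrier_mat k k"
  shows "hs_inner A (B + C) = hs_inner A B + hs_inner A C"
  using assms by (simp add: hs_inner_sum[of _ k] sum.distrib distrib_left)

lemma hs_inner_minus_right:
  assumes "A \<in> carrier_mat k k" "B \<in> carrier_mat k k" "C \<in> carrier_mat k k"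
  shows "hs_inner A (B - C) = hs_inner A B - hs_inner A C"
  using assms by (simp add: hs_inner_sum[of _ k] minus_carrier_mat sum_subtractf right_diff_distrib)

lemma hs_inner_smult_right:
  assumes "A \<in> carrier_mat k k" "B \<in> carrier_mat k k"
  shows "hs_inner A (c \<cdot>\<^sub>m B) = c * hs_inner A B"
  using assms by (simp add: hs_inner_sum[of _ k] sum_distrib_left mult.left_commute)

definition hs_onb :: "nat \<Rightarrow> complex mat list \<Rightarrow> bool" where
  "hs_onb k E \<longleftrightarrow> set E \<subseteq> carrier_mat k k \<and>
     (\<forall>i<length E. \<forall>j<length E. hs_inner (E ! i) (E ! j) = (if i = j then 1 else 0)) \<and>
     (\<forall>A\<in>carrier_mat k k. (\<forall>B\<in>set E. hs_inner B A = 0) \<longrightarrow> A = 0\<^sub>m k k)"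

definition coord :: "complex mat list \<Rightarrow> complex mat \<Rightarrow> complex vec" where
  "coord E A = vec (length E) (\<lambda>i. hs_inner (E ! i) A)"

definition lin_comb :: "nat \<Rightarrow> complex mat list \<Rightarrow> complex vec \<Rightarrow> complex mat" where
  "lin_comb k E v = mat k k (\<lambda>p. \<Sum>i<length E. v $ i * (E ! i) $$ p)"

lemma coord_carrier [simp]: "coord E A \<in> carrier_vec (length E)"
  by (simp add: coord_def)

lemma coord_dim [simp]: "dim_vec (coord E A) = length E"
  by (simp add: coord_def)

lemma coord_index [simp]: "i < length E \<Longrightarrow> coord E A $ i = hs_inner (E ! i) A"
  by (simp add: coord_def)

lemma lin_comb_carrier [simp]: "lin_comb k E v \<in> carrier_mat k k"
  by (simp add: lin_comb_def)

lemma hs_onb_subset: "hs_onb k E \<Longrightarrow> set E \<subseteq> carrier_mat k k"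
  by (simp add: hs_onb_def)

lemma hs_onb_carrier: "hs_onb k E \<Longrightarrow> i < length E \<Longrightarrow> E ! i \<in> carrier_mat k k"
  using hs_onb_subset by fastforce

lemma hs_onb_eq_0:
  assumes "hs_onb k E" "A \<in> carrier_mat k k" "\<And>B. B \<in> set E \<Longrightarrow> hs_inner B A = 0"
  shows "A = 0\<^sub>m k k"
  using assms unfolding hs_onb_def by blast

lemma hs_onb_inner:
  "hs_onb k E \<Longrightarrow> i < length E \<Longrightarrow> j < length E \<Longrightarrow> hs_inner (E ! i) (E ! j) = (if i = j then 1 else 0)"
  by (simp add: hs_onb_def)

lemma hs_onb_neq_0:
  assumes E: "hs_onb k E" and i: "i < length E"
  shows "E ! i \<noteq> 0\<^sub>m k k"
  using hs_onb_inner[OF E i i] by (auto simp: hs_inner_sum[of _ k])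

lemma linear_functional_lin_comb:
  fixes L :: "complex mat \<Rightarrow> complex"
  assumes E: "set E \<subseteq> carrier_mat k k"
    and add: "\<And>A B. A \<in> carrier_mat k k \<Longrightarrow> B \<in> carrier_mat k k \<Longrightarrow> L (A + B) = L A + L B"
    and smult: "\<And>c A. A \<in> carrier_mat k k \<Longrightarrow> L (c \<cdot>\<^sub>m A) = c * L A"
  shows "L (lin_comb k E v) = (\<Sum>i<length E. v $ i * L (E ! i))"
proof -
  have "L (mat k k (\<lambda>p. \<Sum>i<n. v $ i * (E ! i) $$ p)) = (\<Sum>i<n. v $ i * L (E ! i))"
    if "n \<le> length E" for n
    using that
  proof (induction n)
    case 0
    have "mat k k (\<lambda>p. \<Sum>i<0. v $ i * (E ! i) $$ p) = 0 \<cdot>\<^sub>m 0\<^sub>m k k" by (rule eq_matI) auto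
    then show ?case using smult[of "0\<^sub>m k k" 0] by simp
  next
    case (Suc n)
    then have En: "E ! n \<in> carrier_mat k k" using E by auto
    have "mat k k (\<lambda>p. \<Sum>i<Suc n. v $ i * (E ! i) $$ p)
        = mat k k (\<lambda>p. \<Sum>i<n. v $ i * (E ! i) $$ p) + v $ n \<cdot>\<^sub>m E ! n"
      using En by (intro eq_matI) auto
    then show ?case using Suc En by (simp add: add smult)
  qed
  then show ?thesis by (simp add: lin_comb_def)
qed

lemma hs_inner_lin_comb:
  assumes "hs_onb k E" "A \<in> carrier_mat k k"
  shows "hs_inner A (lin_comb k E v) = (\<Sum>i<length E. v $ i * hs_inner A (E ! i))"
  using assms(2)
  by (intro linear_functional_lin_comb[OF hs_onb_subset[OF assms(1)]])
    (simp_all add: hs_inner_add_right[of _ k] hs_inner_smult_right[of _ k])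

lemma coord_lin_comb:
  assumes E: "hs_onb k E" and v: "v \<in> carrier_vec (length E)"
  shows "coord E (lin_comb k E v) = v"
proof (rule eq_vecI)
  fix i assume "i < dim_vec v"
  then have i: "i < length E" using v by simp
  then show "coord E (lin_comb k E v) $ i = v $ i"
    by (simp add: hs_inner_lin_comb[OF E hs_onb_carrier[OF E i]] hs_onb_inner[OF E i]
        if_distrib[of "\<lambda>x. _ * x"] cong: if_cong)
qed (use v in \<open>simp add: coord_def\<close>)

lemma coord_eqI:
  assumes E: "hs_onb k E" and A: "A \<in> carrier_mat k k" and B: "B \<in> carrier_mat k k"
    and coord_eq: "coord E A = coord E B"
  shows "A = B"
proof -
  have "hs_inner C (A - B) = 0" if C: "C \<in> set E" for C
  proof -
    obtain i where i: "i < length E" "C = E ! i" using C by (metis in_set_conv_nth)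
    then show ?thesis
      using arg_cong[OF coord_eq, of "\<lambda>v. v $ i"]
        hs_inner_minus_right[OF hs_onb_carrier[OF E i(1)] A B] by simp
  qed
  then have diff_0: "A - B = 0\<^sub>m k k"
    by (intro hs_onb_eq_0[OF E] minus_carrier_mat B)
  have "A = B + (A - B)" using A B by (intro eq_matI) auto
  also have "\<dots> = B" unfolding diff_0 using B by simp
  finally show ?thesis .
qed

lemma lin_comb_coord:
  assumes "hs_onb k E" "A \<in> carrier_mat k k"
  shows "lin_comb k E (coord E A) = A"
  by (rule coord_eqI[OF assms(1)]) (use assms in \<open>simp_all add: coord_lin_comb\<close>)

lemma hs_inner_coord:
  assumes E: "hs_onb k E" and A: "A \<in> carrier_mat k k" and B: "B \<in> carrier_mat k k"
  shows "hs_inner A B = coord E B \<bullet>c coord E A"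
proof -
  have "hs_inner A B = (\<Sum>i<length E. coord E B $ i * hs_inner A (E ! i))"
    using hs_inner_lin_comb[OF E A, of "coord E B"] by (simp add: lin_comb_coord[OF E B])
  also have "\<dots> = coord E B \<bullet>c coord E A"
    using hs_inner_commute[OF hs_onb_carrier[OF E] A]
    by (simp add: scalar_prod_def lessThan_atLeast0 coord_def)
  finally show ?thesis .
qed

lemma coord_add:
  assumes "hs_onb k E" "A \<in> carrier_mat k k" "B \<in> carrier_mat k k"
  shows "coord E (A + B) = coord E A + coord E B"
  using assms by (intro eq_vecI) (auto simp: coord_def hs_inner_add_right[OF hs_onb_carrier])

lemma coord_smult:
  assumes "hs_onb k E" "A \<in> carrier_mat k k"
  shows "coord E (c \<cdot>\<^sub>m A) = c \<cdot>\<^sub>v coord E A"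
  using assms by (intro eq_vecI) (auto simp: coord_def hs_inner_smult_right[OF hs_onb_carrier])

lemma coord_basis:
  assumes "hs_onb k E" "i < length E"
  shows "coord E (E ! i) = unit_vec (length E) i"
  using assms by (intro eq_vecI) (auto simp: coord_def hs_onb_inner)

definition represents ::
  "nat \<Rightarrow> nat \<Rightarrow> complex mat list \<Rightarrow> complex mat list \<Rightarrow> (complex mat \<Rightarrow> complex mat) \<Rightarrow> complex mat \<Rightarrow> bool" where
  "represents n m E F T M \<longleftrightarrow> M \<in> carrier_mat (length F) (length E) \<and>
     (\<forall>A\<in>carrier_mat n n. T A \<in> carrier_mat m m \<and> coord F (T A) = M *\<^sub>v coord E A)"

lemma representsD:
  assumes "represents n m E F T M"
  shows "M \<in> carrier_mat (length F) (length E)"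
    and "A \<in> carrier_mat n n \<Longrightarrow> T A \<in> carrier_mat m m"
    and "A \<in> carrier_mat n n \<Longrightarrow> coord F (T A) = M *\<^sub>v coord E A"
  using assms by (auto simp: represents_def)

lemma represents_cong:
  assumes "represents n m E F T M" "\<And>A. A \<in> carrier_mat n n \<Longrightarrow> S A = T A"
  shows "represents n m E F S M"
  using assms by (simp add: represents_def)

lemma represents_comp:
  assumes "represents n m E F T M" "represents m l F G S N"
  shows "represents n l E G (S \<circ> T) (N * M)"
  using assms by (auto simp: represents_def assoc_mult_mat_vec[of _ "length G" "length F" _ "length E"])

lemma lin_map_represents:
  assumes E: "hs_onb n E" and F: "hs_onb m F" and T: "lin_map n m T"
  shows "represents n m E F T (mat (length F) (length E) (\<lambda>(i, j). hs_inner (F ! i) (T (E ! j))))"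
    (is "represents _ _ _ _ _ ?M")
  unfolding represents_def
proof (intro conjI ballI)
  fix A :: "complex mat" assume A: "A \<in> carrier_mat n n"
  show "T A \<in> carrier_mat m m" by (rule lin_mapD(1)[OF T A])
  show "coord F (T A) = ?M *\<^sub>v coord E A"
  proof (rule eq_vecI)
    fix i assume "i < dim_vec (?M *\<^sub>v coord E A)"
    then have i: "i < length F" by simp
    note Fi = hs_onb_carrier[OF F i]
    have "hs_inner (F ! i) (T (lin_comb n E (coord E A)))
        = (\<Sum>j<length E. coord E A $ j * hs_inner (F ! i) (T (E ! j)))"
      using Fi by (intro linear_functional_lin_comb[OF hs_onb_subset[OF E]])
        (simp_all add: lin_mapD[OF T] hs_inner_add_right[of _ m] hs_inner_smult_right[of _ m])
    then show "coord F (T A) $ i = (?M *\<^sub>v coord E A) $ i"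
      using i by (simp add: lin_comb_coord[OF E A] scalar_prod_def lessThan_atLeast0 mult.commute)
  qed (simp add: coord_def)
qed simp

lemma represents_imp_lin_map:
  assumes E: "hs_onb n E" and F: "hs_onb m F" and T: "represents n m E F T M"
  shows "lin_map n m T"
  unfolding lin_map_def
proof (intro conjI ballI allI)
  note M = representsD(1)[OF T] and Tc = representsD(2)[OF T] and coord_T = representsD(3)[OF T]
  fix A :: "complex mat" assume A: "A \<in> carrier_mat n n"
  show "T A \<in> carrier_mat m m" by (rule Tc[OF A])
  show "T (c \<cdot>\<^sub>m A) = c \<cdot>\<^sub>m T A" for c
    using A M by (intro coord_eqI[OF F])
      (auto simp: Tc coord_T coord_smult[OF E] coord_smult[OF F] mult_mat_vec[of _ "length F"])
  fix B :: "complex mat" assume B: "B \<in> carrier_mat n n"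
  show "T (A + B) = T A + T B"
    using A B M by (intro coord_eqI[OF F])
      (auto simp: Tc coord_T coord_add[OF E] coord_add[OF F]
        mult_add_distrib_mat_vec[of _ "length F" "length E"])
qed

lemma represents_id: "represents k k E E (\<lambda>A. A) (1\<^sub>m (length E))"
  by (simp add: represents_def)

lemma represents_unique:
  assumes F: "hs_onb m F" and "represents n m E F S M" "represents n m E F T M" "A \<in> carrier_mat n n"
  shows "S A = T A"
  using assms(2-4) by (intro coord_eqI[OF F]) (simp_all add: represents_def)

lemma represents_hs_adjoint:
  assumes E: "hs_onb n E" and F: "hs_onb m F"
    and T: "represents n m E F T M" and adjoint: "hs_adjoint n m T S"
  shows "represents m n F E S (mat_adjoint M)"
  unfolding represents_def
proof (intro conjI ballI)
  note M = representsD(1)[OF T]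
  show "mat_adjoint M \<in> carrier_mat (length E) (length F)" using M by simp
  fix B :: "complex mat" assume B: "B \<in> carrier_mat m m"
  show "S B \<in> carrier_mat n n" using adjoint B by (simp add: hs_adjoint_def)
  show "coord E (S B) = mat_adjoint M *\<^sub>v coord F B"
  proof (rule eq_vecI)
    fix i assume "i < dim_vec (mat_adjoint M *\<^sub>v coord F B)"
    then have i: "i < length E" using M by simp
    note Ei = hs_onb_carrier[OF E i]
    have "coord E (S B) $ i = hs_inner (T (E ! i)) B"
      using adjoint Ei B i by (simp add: hs_adjoint_def)
    also have "\<dots> = coord F B \<bullet>c (M *\<^sub>v unit_vec (length E) i)"
      using hs_inner_coord[OF F representsD(2)[OF T Ei] B] representsD(3)[OF T Ei] coord_basis[OF E i]
      by simp
    also have "\<dots> = (mat_adjoint M *\<^sub>v coord F B) \<bullet>c unit_vec (length E) i"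
      using M cscalar_prod_mat_adjoint[of "mat_adjoint M" "length E" "length F"
        "coord F B" "unit_vec (length E) i"] by simp
    also have "\<dots> = (mat_adjoint M *\<^sub>v coord F B) $ i"
      using i M by simp
    finally show "coord E (S B) $ i = (mat_adjoint M *\<^sub>v coord F B) $ i" .
  qed (use M in \<open>simp add: coord_def\<close>)
qed

lemma represents_conjugation:
  assumes E: "hs_onb n E" and F: "hs_onb m F" and adjoint: "hs_adjoint n m \<phi> \<psi>"
    and V: "represents n m E F \<phi> V" and S: "represents m m F F S M"
  shows "represents n n E E (\<psi> \<circ> S \<circ> \<phi>) (mat_adjoint V * M * V)"
  using represents_comp[OF V represents_comp[OF S represents_hs_adjoint[OF E F V adjoint]]]
  by (simp add: comp_assoc)

lemma hermitian_represents_op_sa: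
  assumes E: "hs_onb k E" and T: "represents k k E E T M" and M: "hermitian_mat (length E) M"
  shows "op_sa k T"
  unfolding op_sa_def
proof (intro ballI)
  fix A B :: "complex mat" assume A: "A \<in> carrier_mat k k" and B: "B \<in> carrier_mat k k"
  show "hs_inner (T A) B = hs_inner A (T B)"
    using cscalar_prod_mat_adjoint[OF hermitian_matD(1)[OF M] coord_carrier coord_carrier, of B A]
      hermitian_matD(2)[OF M]
    by (simp add: hs_inner_coord[OF E] A B representsD[OF T])
qed

lemma op_le_represents_iff:
  assumes E: "hs_onb k E" and S: "represents k k E E S M" and T: "represents k k E E T N"
    and M: "hermitian_mat (length E) M" and N: "hermitian_mat (length E) N"
  shows "op_le k S T \<longleftrightarrow> mat_le (length E) M N"
proof -
  have form: "hs_inner A (T A - S A) = complex_of_real (qform N (coord E A) - qform M (coord E A))"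
    if A: "A \<in> carrier_mat k k" for A
    using hs_inner_minus_right[OF A representsD(2)[OF T A] representsD(2)[OF S A]]
    by (simp add: hs_inner_coord[OF E A] representsD(2,3)[OF T A] representsD(2,3)[OF S A]
        hermitian_mat_qform[OF M] hermitian_mat_qform[OF N])
  show ?thesis
    unfolding op_le_def op_psd_def mat_le_iff_qform[OF M N]
  proof (intro iffI ballI)
    fix v :: "complex vec"
    assume inner_nonneg: "\<forall>A\<in>carrier_mat k k. 0 \<le> hs_inner A (T A - S A)"
      and v: "v \<in> carrier_vec (length E)"
    show "qform M v \<le> qform N v"
      using inner_nonneg[rule_format, OF lin_comb_carrier, of E v] form[OF lin_comb_carrier, of E v]
      by (simp add: coord_lin_comb[OF E v] less_eq_complex_def)
  next
    fix A :: "complex mat" assume "\<forall>v\<in>carrier_vec (length E). qform M v \<le> qform N v"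
        "A \<in> carrier_mat k k"
    then show "0 \<le> hs_inner A (T A - S A)" by (simp add: form less_eq_complex_def)
  qed
qed

definition outer_prod :: "complex vec \<Rightarrow> complex vec \<Rightarrow> complex mat" where
  "outer_prod u w = mat (dim_vec u) (dim_vec w) (\<lambda>(i, j). u $ i * cnj (w $ j))"

lemma outer_prod_carrier [simp]:
  "u \<in> carrier_vec n \<Longrightarrow> w \<in> carrier_vec m \<Longrightarrow> outer_prod u w \<in> carrier_mat n m"
  by (simp add: outer_prod_def)

lemma hs_inner_outer_prod:
  assumes "u \<in> carrier_vec k" "w \<in> carrier_vec k" "A \<in> carrier_mat k k"
  shows "hs_inner (outer_prod u w) A = (A *\<^sub>v w) \<bullet>c u"
proof -
  have "hs_inner (outer_prod u w) A = (\<Sum>i<k. \<Sum>j<k. cnj (outer_prod u w $$ (i, j)) * A $$ (i, j))"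
    using assms by (simp add: hs_inner_sum[of _ k]) (rule sum.swap)
  then show ?thesis
    using assms
    by (simp add: outer_prod_def scalar_prod_def lessThan_atLeast0 sum_distrib_left
        sum_distrib_right mult_ac)
qed

lemma mult_outer_prod:
  assumes "A \<in> carrier_mat n m" "u \<in> carrier_vec m"
  shows "A * outer_prod u w = outer_prod (A *\<^sub>v u) w"
  using assms by (intro eq_matI) (auto simp: outer_prod_def scalar_prod_def sum_distrib_right mult.assoc)

lemma outer_prod_mult:
  assumes "A \<in> carrier_mat m n" "w \<in> carrier_vec m"
  shows "outer_prod u w * A = outer_prod u (mat_adjoint A *\<^sub>v w)"
  using assms by (intro eq_matI) (auto simp: outer_prod_def scalar_prod_def sum_distrib_left mult_ac)

lemma outer_prod_mult_vec:
  assumes "u \<in> carrier_vec n" "w \<in> carrier_vec m" "v \<in> carrier_vec m"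
  shows "outer_prod u w *\<^sub>v v = (v \<bullet>c w) \<cdot>\<^sub>v u"
  using assms by (intro eq_vecI) (auto simp: outer_prod_def scalar_prod_def sum_distrib_left mult_ac)

lemma outer_prod_smult:
  "outer_prod (c \<cdot>\<^sub>v u) w = c \<cdot>\<^sub>m outer_prod u w" "outer_prod u (c \<cdot>\<^sub>v w) = cnj c \<cdot>\<^sub>m outer_prod u w"
  by (rule eq_matI; simp add: outer_prod_def)+

definition unitary_onb :: "nat \<Rightarrow> complex mat \<Rightarrow> complex mat \<Rightarrow> complex mat list" where
  "unitary_onb k U V = map (\<lambda>l. outer_prod (col U (l div k)) (col V (l mod k))) [0..<k * k]"

lemma length_unitary_onb [simp]: "length (unitary_onb k U V) = k * k"
  by (simp add: unitary_onb_def)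

lemma div_mod_less_square: "l < k * k \<Longrightarrow> l div k < k \<and> l mod k < k" for k l :: nat
  by (cases "k = 0") (auto simp: less_mult_imp_div_less)

lemma unitary_onb_nth:
  "l < k * k \<Longrightarrow> unitary_onb k U V ! l = outer_prod (col U (l div k)) (col V (l mod k))"
  by (simp add: unitary_onb_def)

lemma unitary_mat_cscalar_prod_col:
  assumes U: "unitary_mat k U" and ij: "i < k" "j < k"
  shows "col U j \<bullet>c col U i = (if i = j then 1 else 0)"
  using cscalar_prod_mult_col[OF one_carrier_mat unitary_matD(1)[OF U] unitary_matD(1)[OF U] ij]
    unitary_matD[OF U] ij by simp

lemma hs_inner_unitary_onb:
  assumes U: "unitary_mat k U" and V: "unitary_mat k V" and l: "l < k * k" "l' < k * k"
  shows "hs_inner (unitary_onb k U V ! l) (unitary_onb k U V ! l') = (if l = l' then 1 else 0)"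
proof -
  note lk = div_mod_less_square[OF l(1)] div_mod_less_square[OF l(2)]
  have col: "col U i \<in> carrier_vec k" "col V i \<in> carrier_vec k" if "i < k" for i
    using unitary_matD(1)[OF U] unitary_matD(1)[OF V] that by auto
  have "hs_inner (unitary_onb k U V ! l) (unitary_onb k U V ! l')
      = (col V (l mod k) \<bullet>c col V (l' mod k)) * (col U (l' div k) \<bullet>c col U (l div k))"
    using l lk col by (simp add: unitary_onb_nth hs_inner_outer_prod[of _ k] outer_prod_mult_vec[of _ k _ k])
  also have "\<dots> = (if l div k = l' div k \<and> l mod k = l' mod k then 1 else 0)"
    using lk by (simp add: unitary_mat_cscalar_prod_col[OF U] unitary_mat_cscalar_prod_col[OF V])
  also have "l div k = l' div k \<and> l mod k = l' mod k \<longleftrightarrow> l = l'"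
    by (metis div_mult_mod_eq)
  finally show ?thesis .
qed

lemma unitary_onb_total:
  assumes U: "unitary_mat k U" and V: "unitary_mat k V" and A: "A \<in> carrier_mat k k"
    and orth: "\<And>l. l < k * k \<Longrightarrow> hs_inner (unitary_onb k U V ! l) A = 0"
  shows "A = 0\<^sub>m k k"
proof -
  note Uc = unitary_matD[OF U] and Vc = unitary_matD[OF V]
  have "mat_adjoint U * A * V = 0\<^sub>m k k"
  proof (rule eq_matI)
    fix i j assume "i < dim_row (0\<^sub>m k k :: complex mat)" "j < dim_col (0\<^sub>m k k :: complex mat)"
    then have ij: "i < k" "j < k" by auto
    then have "i * k + j < k * k" using mult_le_mono1[of "Suc i" k k] by simp
    then have "hs_inner (outer_prod (col U i) (col V j)) A = 0"
      using orth[of "i * k + j"] ij by (simp add: unitary_onb_nth)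
    then show "(mat_adjoint U * A * V) $$ (i, j) = 0\<^sub>m k k $$ (i, j)"
      using cscalar_prod_mult_col[OF A Uc(1) Vc(1) ij] hs_inner_outer_prod[of "col U i" k "col V j" A]
        ij A Uc Vc by simp
  qed (use A Uc Vc in auto)
  then have "U * (mat_adjoint U * A * V) * mat_adjoint V = 0\<^sub>m k k"
    using Uc Vc by simp
  moreover have "U * (mat_adjoint U * A * V) * mat_adjoint V
      = (U * mat_adjoint U) * A * (V * mat_adjoint V)"
    using A Uc(1) Vc(1) by (simp add: assoc_mult_mat[of _ k k _ k _ k] mult_carrier_mat[of _ k k _ k])
  ultimately show ?thesis using A Uc Vc by simp
qed

lemma hs_onb_unitary_onb:
  assumes U: "unitary_mat k U" and V: "unitary_mat k V"
  shows "hs_onb k (unitary_onb k U V)"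
proof -
  have "set (unitary_onb k U V) \<subseteq> carrier_mat k k"
    using div_mod_less_square[of _ k] unitary_matD(1)[OF U] unitary_matD(1)[OF V]
    by (auto simp: unitary_onb_def carrier_vecI)
  moreover have "A = 0\<^sub>m k k"
    if "A \<in> carrier_mat k k" "\<forall>B\<in>set (unitary_onb k U V). hs_inner B A = 0" for A
    using that by (intro unitary_onb_total[OF U V]) (auto simp: all_set_conv_all_nth)
  ultimately show ?thesis
    by (simp add: hs_onb_def hs_inner_unitary_onb[OF U V])
qed

lemma hs_inner_eqI:
  assumes A: "A \<in> carrier_mat k k" and B: "B \<in> carrier_mat k k"
    and inner_eq: "\<And>C. C \<in> carrier_mat k k \<Longrightarrow> hs_inner C A = hs_inner C B"
  shows "A = B"
proof -
  have E: "hs_onb k (unitary_onb k (1\<^sub>m k) (1\<^sub>m k))" by (rule hs_onb_unitary_onb) simp_all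
  show ?thesis
    by (rule coord_eqI[OF E A B], rule eq_vecI) (use inner_eq hs_onb_carrier[OF E] in auto)
qed

section \<open>Operators diagonal in an orthonormal basis\<close>

abbreviation diag_op :: "nat \<Rightarrow> complex mat list \<Rightarrow> (nat \<Rightarrow> real) \<Rightarrow> (complex mat \<Rightarrow> complex mat) \<Rightarrow> bool" where
  "diag_op k E d T \<equiv> represents k k E E T (rdiag (length E) d)"

lemma diag_opI:
  assumes E: "hs_onb k E" and T: "lin_map k k T"
    and eigen: "\<And>i. i < length E \<Longrightarrow> T (E ! i) = complex_of_real (d i) \<cdot>\<^sub>m E ! i"
  shows "diag_op k E d T"
proof -
  have "mat (length E) (length E) (\<lambda>(i, j). hs_inner (E ! i) (T (E ! j))) = rdiag (length E) d"
    by (rule eq_matI)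
      (auto simp: eigen hs_inner_smult_right[OF hs_onb_carrier[OF E] hs_onb_carrier[OF E]]
          hs_onb_inner[OF E])
  then show ?thesis using lin_map_represents[OF E E T] by simp
qed

lemma diag_op_basis:
  assumes E: "hs_onb k E" and T: "diag_op k E d T" and i: "i < length E"
  shows "T (E ! i) = complex_of_real (d i) \<cdot>\<^sub>m E ! i"
proof (rule coord_eqI[OF E])
  note Ei = hs_onb_carrier[OF E i]
  show "T (E ! i) \<in> carrier_mat k k" by (rule representsD(2)[OF T Ei])
  have "rdiag (length E) d *\<^sub>v unit_vec (length E) i = complex_of_real (d i) \<cdot>\<^sub>v unit_vec (length E) i"
    using i by (intro eq_vecI) (auto simp: rdiag_mult_vec)
  then show "coord E (T (E ! i)) = coord E (complex_of_real (d i) \<cdot>\<^sub>m E ! i)"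
    using representsD(3)[OF T Ei] by (simp add: coord_smult[OF E Ei] coord_basis[OF E i])
qed (use hs_onb_carrier[OF E i] in simp)

lemma diag_op_comp:
  assumes "diag_op k E a S" "diag_op k E b T"
  shows "diag_op k E (\<lambda>i. a i * b i) (S \<circ> T)"
  using represents_comp[OF assms(2,1)] by simp

lemma diag_op_exists:
  assumes E: "hs_onb k E"
  obtains T where "diag_op k E d T"
proof
  show "diag_op k E d (\<lambda>A. lin_comb k E (rdiag (length E) d *\<^sub>v coord E A))"
    by (simp add: represents_def coord_lin_comb[OF E])
qed

definition moore_penrose :: "nat \<Rightarrow> (complex mat \<Rightarrow> complex mat) \<Rightarrow> (complex mat \<Rightarrow> complex mat) \<Rightarrow> bool" where
  "moore_penrose k T S \<longleftrightarrow> lin_map k k S \<and>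
     (\<forall>A\<in>carrier_mat k k. T (S (T A)) = T A \<and> S (T (S A)) = S A) \<and> op_sa k (T \<circ> S) \<and> op_sa k (S \<circ> T)"

lemma op_sa_comp_commute:
  assumes P: "op_sa k P" and Q: "op_sa k Q" and R: "op_sa k R"
    and carrier: "\<And>A. A \<in> carrier_mat k k \<Longrightarrow> P A \<in> carrier_mat k k"
      "\<And>A. A \<in> carrier_mat k k \<Longrightarrow> Q A \<in> carrier_mat k k"
      "\<And>A. A \<in> carrier_mat k k \<Longrightarrow> R A \<in> carrier_mat k k"
    and PQ: "\<And>A. A \<in> carrier_mat k k \<Longrightarrow> P (Q A) = R A" and A: "A \<in> carrier_mat k k"
  shows "Q (P A) = R A"
proof (rule hs_inner_eqI)
  fix C :: "complex mat" assume C: "C \<in> carrier_mat k k"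
  have "hs_inner C (Q (P A)) = hs_inner (Q C) (P A)"
    using Q C A carrier by (simp add: op_sa_def)
  also have "\<dots> = hs_inner (R C) A"
    using P C A carrier by (simp add: op_sa_def PQ[symmetric])
  also have "\<dots> = hs_inner C (R A)"
    using R C A by (simp add: op_sa_def)
  finally show "hs_inner C (Q (P A)) = hs_inner C (R A)" .
qed (use A carrier in auto)

text \<open>Both \<open>S T\<close> and \<open>S' T\<close> are the orthogonal projection along the kernel of \<open>T\<close>, and \<open>T S\<close> and
  \<open>T S'\<close> are the one onto its range.\<close>

lemma moore_penrose_unique:
  assumes T: "lin_map k k T" and S: "moore_penrose k T S" and S': "moore_penrose k T S'"
    and A: "A \<in> carrier_mat k k"
  shows "S A = S' A"
proof -
  have carrier: "T B \<in> carrier_mat k k" "S B \<in> carrier_mat k k" "S' B \<in> carrier_mat k k"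
    if "B \<in> carrier_mat k k" for B
    using T S S' that by (auto simp: moore_penrose_def lin_map_def)
  have TST: "T (S (T B)) = T B" "T (S' (T B)) = T B" and STS: "S (T (S B)) = S B" "S' (T (S' B)) = S' B"
    if "B \<in> carrier_mat k k" for B
    using S S' that by (auto simp: moore_penrose_def)
  have self_adjoint: "op_sa k (T \<circ> S)" "op_sa k (S \<circ> T)" "op_sa k (T \<circ> S')" "op_sa k (S' \<circ> T)"
    using S S' by (auto simp: moore_penrose_def)
  have ST: "S (T B) = S' (T B)" if B: "B \<in> carrier_mat k k" for B
    using op_sa_comp_commute[OF self_adjoint(2,4,2), of B] B by (simp add: carrier TST)
  have TS: "T (S B) = T (S' B)" if B: "B \<in> carrier_mat k k" for B
    using op_sa_comp_commute[OF self_adjoint(1,3,3), of B] B by (simp add: carrier TST)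
  have "S A = S (T (S' A))" using A by (simp add: STS flip: TS)
  also have "\<dots> = S' A" using A by (simp add: ST STS carrier)
  finally show ?thesis .
qed

lemma diag_op_mp:
  assumes E: "hs_onb k E" and T: "diag_op k E d T"
  shows "diag_op k E (\<lambda>i. inverse (d i)) (op_mp k T)"
proof -
  obtain S where S: "diag_op k E (\<lambda>i. inverse (d i)) S" using diag_op_exists[OF E] .
  have linear: "lin_map k k T" "lin_map k k S"
    using represents_imp_lin_map[OF E E] T S by auto
  have "T (S (T A)) = T A" "S (T (S A)) = S A" if A: "A \<in> carrier_mat k k" for A
  proof -
    have "(\<lambda>i. d i * (inverse (d i) * d i)) = d"
      "(\<lambda>i. inverse (d i) * (d i * inverse (d i))) = (\<lambda>i. inverse (d i))"
      by (auto simp: fun_eq_iff field_simps)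
    then have "diag_op k E d (T \<circ> (S \<circ> T))" "diag_op k E (\<lambda>i. inverse (d i)) (S \<circ> (T \<circ> S))"
      using diag_op_comp[OF T diag_op_comp[OF S T]] diag_op_comp[OF S diag_op_comp[OF T S]] by simp_all
    then show "T (S (T A)) = T A" "S (T (S A)) = S A"
      using represents_unique[OF E _ T A] represents_unique[OF E _ S A] by (metis comp_apply)+
  qed
  moreover have "op_sa k (T \<circ> S)" "op_sa k (S \<circ> T)"
    using hermitian_represents_op_sa[OF E] diag_op_comp[OF T S] diag_op_comp[OF S T] by auto
  ultimately have S_mp: "moore_penrose k T S"
    using linear by (simp add: moore_penrose_def)
  then have "moore_penrose k T (op_mp k T)"
    unfolding op_mp_def moore_penrose_def[symmetric] by (rule someI[of "moore_penrose k T"])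
  then have "op_mp k T A = S A" if "A \<in> carrier_mat k k" for A
    using moore_penrose_unique[OF linear(1) _ S_mp that] by simp
  then show ?thesis by (rule represents_cong[OF S])
qed

lemma diag_op_inv:
  assumes E: "hs_onb k E" and T: "diag_op k E d T" and d: "\<And>i. i < length E \<Longrightarrow> d i \<noteq> 0"
  shows "diag_op k E (\<lambda>i. inverse (d i)) (op_inv k T)"
proof -
  obtain S where S: "diag_op k E (\<lambda>i. inverse (d i)) S" using diag_op_exists[OF E] .
  let ?inv = "\<lambda>S. lin_map k k S \<and> (\<forall>A\<in>carrier_mat k k. S (T A) = A \<and> T (S A) = A)"
  have "rdiag (length E) (\<lambda>i. d i * inverse (d i)) = 1\<^sub>m (length E)"
    using d by (intro eq_matI) auto
  then have "represents k k E E (T \<circ> S) (1\<^sub>m (length E))" "represents k k E E (S \<circ> T) (1\<^sub>m (length E))"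
    using diag_op_comp[OF T S] diag_op_comp[OF S T] by (simp_all add: mult.commute)
  then have "S (T A) = A \<and> T (S A) = A" if "A \<in> carrier_mat k k" for A
    using represents_unique[OF E _ represents_id that] by (metis comp_apply)
  then have "?inv S" using represents_imp_lin_map[OF E E S] by blast
  moreover from this have "?inv (op_inv k T)"
    unfolding op_inv_def by (rule someI[of ?inv])
  ultimately have "op_inv k T A = S A" if "A \<in> carrier_mat k k" for A
    using that by (metis lin_mapD(1))
  then show ?thesis by (rule represents_cong[OF S])
qed

lemma diag_op_fun:
  assumes E: "hs_onb k E" and T: "diag_op k E d T"
  shows "diag_op k E (\<lambda>i. f (d i)) (op_fun k f T)"
proof -
  let ?fun = "\<lambda>S. lin_map k k S \<and> (\<forall>c A. A \<in> carrier_mat k k \<and> A \<noteq> 0\<^sub>m k k \<and> T A = c \<cdot>\<^sub>m A \<longrightarrow>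
    S A = complex_of_real (f (Re c)) \<cdot>\<^sub>m A)"
  obtain S where S: "diag_op k E (\<lambda>i. f (d i)) S" using diag_op_exists[OF E] .
  have "S A = complex_of_real (f (Re c)) \<cdot>\<^sub>m A"
    if A: "A \<in> carrier_mat k k" and eigen: "T A = c \<cdot>\<^sub>m A" for c A
  proof (rule coord_eqI[OF E])
    have "rdiag (length E) d *\<^sub>v coord E A = c \<cdot>\<^sub>v coord E A"
      using representsD(3)[OF T A] eigen by (simp add: coord_smult[OF E A])
    then show "coord E (S A) = coord E (complex_of_real (f (Re c)) \<cdot>\<^sub>m A)"
      using representsD(3)[OF S A] rdiag_eigenvector[of "coord E A" "length E" d c f]
      by (simp add: coord_smult[OF E A])
  qed (use A representsD(2)[OF S A] in auto)
  then have "?fun S" using represents_imp_lin_map[OF E E S] by blast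
  then have op_fun: "?fun (op_fun k f T)" unfolding op_fun_def by (rule someI[of ?fun])
  show ?thesis
  proof (rule diag_opI[OF E])
    show "lin_map k k (op_fun k f T)" using op_fun by blast
    fix i assume i: "i < length E"
    have "E ! i \<noteq> 0\<^sub>m k k" by (rule hs_onb_neq_0[OF E i])
    moreover have "T (E ! i) = complex_of_real (d i) \<cdot>\<^sub>m E ! i" by (rule diag_op_basis[OF E T i])
    ultimately show "op_fun k f T (E ! i) = complex_of_real (f (d i)) \<cdot>\<^sub>m E ! i"
      using op_fun hs_onb_carrier[OF E i] by (metis Re_complex_of_real)
  qed
qed

lemma lin_map_lmul: "Y \<in> carrier_mat k k \<Longrightarrow> lin_map k k (lmul Y)"
  by (simp add: lin_map_def lmul_def mult_carrier_mat[of _ k k _ k] mult_add_distrib_mat[of _ k k _ k]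
      mult_smult_distrib[of _ k k _ k])

lemma lin_map_rmul: "X \<in> carrier_mat k k \<Longrightarrow> lin_map k k (rmul X)"
  by (simp add: lin_map_def rmul_def mult_carrier_mat[of _ k k _ k] add_mult_distrib_mat[of _ k k _ _ k]
      mult_smult_assoc_mat[of _ k k _ k])

lemma diag_op_lmul:
  assumes U: "unitary_mat k U" and V: "unitary_mat k V"
  shows "diag_op k (unitary_onb k U V) (\<lambda>l. \<mu> (l div k)) (lmul (unitary_diag k U \<mu>))"
proof (rule diag_opI[OF hs_onb_unitary_onb[OF U V]])
  note Uc = unitary_matD(1)[OF U]
  let ?Y = "unitary_diag k U \<mu>"
  show "lin_map k k (lmul ?Y)"
    using Uc by (simp add: lin_map_lmul)
  fix l assume "l < length (unitary_onb k U V)"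
  then have l: "l < k * k" "l div k < k" using div_mod_less_square by auto
  have "?Y * outer_prod (col U (l div k)) (col V (l mod k))
      = outer_prod (?Y *\<^sub>v col U (l div k)) (col V (l mod k))"
    using Uc l by (intro mult_outer_prod[of _ k k]) auto
  then show "lmul ?Y (unitary_onb k U V ! l) = complex_of_real (\<mu> (l div k)) \<cdot>\<^sub>m unitary_onb k U V ! l"
    using l by (simp add: lmul_def unitary_onb_nth unitary_diag_mult_col[OF U] outer_prod_smult)
qed

lemma diag_op_rmul:
  assumes U: "unitary_mat k U" and V: "unitary_mat k V"
  shows "diag_op k (unitary_onb k U V) (\<lambda>l. \<kappa> (l mod k)) (rmul (unitary_diag k V \<kappa>))"
proof (rule diag_opI[OF hs_onb_unitary_onb[OF U V]])
  note Vc = unitary_matD(1)[OF V]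
  let ?X = "unitary_diag k V \<kappa>"
  show "lin_map k k (rmul ?X)"
    using Vc by (simp add: lin_map_rmul)
  fix l assume "l < length (unitary_onb k U V)"
  then have l: "l < k * k" "l mod k < k" using div_mod_less_square by auto
  have "outer_prod (col U (l div k)) (col V (l mod k)) * ?X
      = outer_prod (col U (l div k)) (mat_adjoint ?X *\<^sub>v col V (l mod k))"
    using Vc l by (intro outer_prod_mult[of _ k k]) auto
  then show "rmul ?X (unitary_onb k U V ! l) = complex_of_real (\<kappa> (l mod k)) \<cdot>\<^sub>m unitary_onb k U V ! l"
    using l hermitian_matD(2)[OF hermitian_mat_unitary_diag[OF Vc]]
    by (simp add: rmul_def unitary_onb_nth unitary_diag_mult_col[OF V] outer_prod_smult)
qed

lemma diag_op_Jf:
  assumes U: "unitary_mat k U" and V: "unitary_mat k V"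
  shows "diag_op k (unitary_onb k U V) (\<lambda>l. f (\<kappa> (l mod k) / \<mu> (l div k)) * \<mu> (l div k))
    (Jf k f (unitary_diag k V \<kappa>) (unitary_diag k U \<mu>))"
  unfolding Jf_def divide_inverse
  by (intro diag_op_comp diag_op_fun diag_op_mp diag_op_lmul diag_op_rmul hs_onb_unitary_onb U V)

lemma Jf_diag_op_psd:
  assumes "psd_mat k X" "psd_mat k Y"
  obtains E g where "hs_onb k E" "diag_op k E g (Jf k f X Y)"
proof -
  obtain U \<mu> where "unitary_mat k U" "Y = unitary_diag k U \<mu>"
    using psd_mat_spectral[OF assms(2)] by metis
  moreover obtain V \<kappa> where "unitary_mat k V" "X = unitary_diag k V \<kappa>"
    using psd_mat_spectral[OF assms(1)] by metis
  ultimately show thesis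
    using that hs_onb_unitary_onb diag_op_Jf by blast
qed

lemma Jf_diag_op_pd:
  assumes "pd_mat k X" "pd_mat k Y" and f: "\<And>x. x > 0 \<Longrightarrow> f x > 0"
  obtains E g where "hs_onb k E" "diag_op k E g (Jf k f X Y)" "\<And>l. l < length E \<Longrightarrow> 0 < g l"
proof -
  obtain U \<mu> where U: "unitary_mat k U" "Y = unitary_diag k U \<mu>" "\<And>i. i < k \<Longrightarrow> 0 < \<mu> i"
    using pd_mat_spectral[OF assms(2)] by metis
  obtain V \<kappa> where V: "unitary_mat k V" "X = unitary_diag k V \<kappa>" "\<And>i. i < k \<Longrightarrow> 0 < \<kappa> i"
    using pd_mat_spectral[OF assms(1)] by metis
  have "0 < f (\<kappa> (l mod k) / \<mu> (l div k)) * \<mu> (l div k)" if "l < length (unitary_onb k U V)" for l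
    using that div_mod_less_square[of l k] U(3) V(3) f by (simp add: mult_pos_pos)
  then show thesis
    by (rule that[OF hs_onb_unitary_onb[OF U(1) V(1)] diag_op_Jf[OF U(1) V(1), of f \<kappa> \<mu>, folded U(2) V(2)]])
qed

lemma op_le_conjugation_iff:
  assumes E: "hs_onb n E" and F: "hs_onb m F" and adjoint: "hs_adjoint n m \<phi> \<psi>"
    and V: "represents n m E F \<phi> V" and S: "diag_op m F a S" and T: "diag_op n E b T"
  shows "op_le n (\<psi> \<circ> S \<circ> \<phi>) T
    \<longleftrightarrow> mat_le (length E) (mat_adjoint V * rdiag (length F) a * V) (rdiag (length E) b)"
  using representsD(1)[OF V]
  by (intro op_le_represents_iff[OF E represents_conjugation[OF E F adjoint V S] T]
      hermitian_mat_congruence) auto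

lemma op_le_conjugation_imp_inverse_conjugation_le:
  assumes E: "hs_onb n E" and F: "hs_onb m F" and \<phi>: "lin_map n m \<phi>" and adjoint: "hs_adjoint n m \<phi> \<psi>"
    and S: "diag_op m F a S" and T: "diag_op n E b T" and pos: "\<And>l. l < length F \<Longrightarrow> 0 < a l"
    and conjugation_le: "op_le n (\<psi> \<circ> S \<circ> \<phi>) T"
  shows "op_le m (\<phi> \<circ> op_mp n T \<circ> \<psi>) (op_inv m S)"
proof -
  obtain V where V: "represents n m E F \<phi> V"
    using lin_map_represents[OF E F \<phi>] by blast
  note Vc = representsD(1)[OF V]
  define G where "G = rdiag (length E) (\<lambda>l. inverse (b l))"
  have G_mp: "represents n n E E (op_mp n T) G"
    unfolding G_def by (rule diag_op_mp[OF E T])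
  have S_inv: "diag_op m F (\<lambda>l. inverse (a l)) (op_inv m S)"
    using pos by (intro diag_op_inv[OF F S]) force
  have "represents m m F F (\<phi> \<circ> op_mp n T \<circ> \<psi>) (V * (G * mat_adjoint V))"
    using represents_comp[OF represents_comp[OF represents_hs_adjoint[OF E F V adjoint] G_mp] V]
    by (simp add: comp_assoc)
  then have conjugate_mp: "represents m m F F (\<phi> \<circ> op_mp n T \<circ> \<psi>) (V * G * mat_adjoint V)"
    using Vc by (simp add: G_def assoc_mult_mat[of _ "length F" "length E" _ "length E" _ "length F"])
  have "rdiag (length F) (\<lambda>l. a l * inverse (a l)) = 1\<^sub>m (length F)"
    using pos by (intro eq_matI) force+
  moreover have "(\<lambda>l. inverse (b l) * b l * inverse (b l)) = (\<lambda>l. inverse (b l))"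
    by (auto simp: fun_eq_iff field_simps)
  moreover have "psd_mat (length F) (rdiag (length F) a)"
    using pos by (simp add: pd_mat_imp_psd_mat pd_mat_rdiag_iff)
  ultimately have "mat_le (length F) (V * G * mat_adjoint V) (rdiag (length F) (\<lambda>l. inverse (a l)))"
    using conjugation_le[unfolded op_le_conjugation_iff[OF E F adjoint V S T]]
    by (intro congruence_le_imp_inverse_congruence_le[OF Vc, of "rdiag (length F) a" "rdiag (length E) b"])
      (simp_all add: G_def)
  then show ?thesis
    using op_le_represents_iff[OF F conjugate_mp S_inv]
      hermitian_mat_congruence_adjoint[OF hermitian_mat_rdiag Vc]
    by (simp add: G_def)
qed

section \<open>Positive maps and Schwarz maps\<close>

lemma psd_mat_outer_prod:
  assumes v: "v \<in> carrier_vec k"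
  shows "psd_mat k (outer_prod v v)"
  unfolding psd_mat_def
proof (intro conjI ballI)
  fix x :: "complex vec" assume x: "x \<in> carrier_vec k"
  have "(outer_prod v v *\<^sub>v x) \<bullet>c x = (x \<bullet>c v) * cnj (x \<bullet>c v)"
    using v x cscalar_prod_commute[OF x v] by (simp add: outer_prod_mult_vec[of _ k _ k])
  then show "0 \<le> (outer_prod v v *\<^sub>v x) \<bullet>c x"
    by (simp add: complex_norm_square[symmetric] less_eq_complex_def)
qed (use v in simp)

lemma psd_mat_diag_nonneg:
  assumes "psd_mat k A" "i < k"
  shows "0 \<le> A $$ (i, i)"
proof -
  have "(A *\<^sub>v unit_vec k i) \<bullet>c unit_vec k i = A $$ (i, i)"
    using assms carrier_matD[OF psd_mat_carrier[OF assms(1)]]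
    by (simp add: psd_mat_carrier mult_mat_vec_unit_vec[of _ k k])
  then show ?thesis
    using assms unfolding psd_mat_def by (metis unit_vec_carrier)
qed

lemma mtrace_mult_psd_nonneg:
  assumes A: "psd_mat k A" and B: "psd_mat k B"
  shows "0 \<le> mtrace (A * B)"
proof -
  obtain N where N: "N \<in> carrier_mat k k" and AN: "A = mat_adjoint N * N"
    using psd_mat_factorization[OF A] .
  have N': "mat_adjoint N \<in> carrier_mat k k" using N by simp
  note Bc = psd_mat_carrier[OF B]
  have conjugate_psd: "psd_mat k (N * B * mat_adjoint N)"
    using psd_mat_congruence[OF B N'] by simp
  have "mtrace (A * B) = mtrace (mat_adjoint N * (N * B))"
    unfolding AN using N N' Bc by (simp add: assoc_mult_mat[of _ k k _ k _ k])
  also have "\<dots> = mtrace (N * B * mat_adjoint N)"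
    using N N' Bc by (intro mtrace_mult_commute[of _ k k]) auto
  also have "0 \<le> \<dots>"
    using psd_mat_diag_nonneg[OF conjugate_psd] psd_mat_carrier[OF conjugate_psd]
    by (auto simp: mtrace_def intro!: sum_nonneg)
  finally show ?thesis .
qed

lemma mtrace_mult_mono:
  assumes "mat_le k A B" "psd_mat k X"
  shows "mtrace (A * X) \<le> mtrace (B * X)"
proof -
  have carriers: "A \<in> carrier_mat k k" "B \<in> carrier_mat k k" "X \<in> carrier_mat k k"
    using assms by (auto simp: mat_le_def psd_mat_carrier)
  have "mtrace ((B - A) * X) = mtrace (B * X) - mtrace (A * X)"
    using carriers by (simp add: minus_mult_distrib_mat[of _ k k] mtrace_def sum_subtractf)
  then show ?thesis
    using mtrace_mult_psd_nonneg[of k "B - A" X] assms by (simp add: mat_le_def)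
qed

lemma hs_inner_adjoint:
  assumes "A \<in> carrier_mat k k" "B \<in> carrier_mat k k"
  shows "hs_inner (mat_adjoint A) (mat_adjoint B) = hs_inner B A"
  using assms by (simp add: hs_inner_sum[of _ k] mult.commute) (rule sum.swap)

lemma hs_inner_mult_left:
  assumes "A \<in> carrier_mat k k" "X \<in> carrier_mat k k"
  shows "hs_inner A (X * A) = hs_inner (mat_adjoint A) (mat_adjoint A * X)"
proof -
  have A': "mat_adjoint A \<in> carrier_mat k k" using assms by simp
  have "hs_inner A (X * A) = mtrace ((mat_adjoint A * X) * A)"
    using assms A' by (simp add: hs_inner_def assoc_mult_mat[of _ k k _ k _ k])
  also have "\<dots> = mtrace (A * (mat_adjoint A * X))"
    using assms A' by (intro mtrace_mult_commute[of _ k k]) auto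
  finally show ?thesis by (simp add: hs_inner_def)
qed

locale positive_map =
  fixes n m :: nat and \<phi> \<phi>adj :: "complex mat \<Rightarrow> complex mat"
  assumes lin: "lin_map n m \<phi>" and adj: "hs_adjoint n m \<phi> \<phi>adj"
    and psd: "psd_mat n A \<Longrightarrow> psd_mat m (\<phi> A)"
begin

lemma adj_carrier: "B \<in> carrier_mat m m \<Longrightarrow> \<phi>adj B \<in> carrier_mat n n"
  using adj by (simp add: hs_adjoint_def)

lemma adj_inner: "A \<in> carrier_mat n n \<Longrightarrow> B \<in> carrier_mat m m \<Longrightarrow> hs_inner (\<phi> A) B = hs_inner A (\<phi>adj B)"
  using adj by (simp add: hs_adjoint_def)

lemma adj_psd:
  assumes X: "psd_mat m X"
  shows "psd_mat n (\<phi>adj X)"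
  unfolding psd_mat_def
proof (intro conjI ballI)
  note Xc = psd_mat_carrier[OF X]
  show "\<phi>adj X \<in> carrier_mat n n" by (rule adj_carrier[OF Xc])
  fix v :: "complex vec" assume v: "v \<in> carrier_vec n"
  let ?P = "\<phi> (outer_prod v v)"
  have P: "psd_mat m ?P" by (rule psd[OF psd_mat_outer_prod[OF v]])
  have "(\<phi>adj X *\<^sub>v v) \<bullet>c v = hs_inner ?P X"
    using v Xc by (simp add: hs_inner_outer_prod[symmetric] adj_carrier adj_inner)
  also have "\<dots> = mtrace (?P * X)"
    by (simp add: hs_inner_def psd_mat_mat_adjoint[OF P])
  finally show "0 \<le> (\<phi>adj X *\<^sub>v v) \<bullet>c v"
    using mtrace_mult_psd_nonneg[OF P X] by simp
qed

lemma map_mat_adjoint: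
  assumes K: "K \<in> carrier_mat n n"
  shows "\<phi> (mat_adjoint K) = mat_adjoint (\<phi> K)"
proof (rule mat_eq_if_cscalar_prod_eq)
  have K': "mat_adjoint K \<in> carrier_mat n n" using K by simp
  note \<phi>K = lin_mapD(1)[OF lin K] and \<phi>K' = lin_mapD(1)[OF lin K']
  show "\<phi> (mat_adjoint K) \<in> carrier_mat m m" "mat_adjoint (\<phi> K) \<in> carrier_mat m m"
    using \<phi>K \<phi>K' by auto
  fix v :: "complex vec" assume v: "v \<in> carrier_vec m"
  let ?P = "outer_prod v v"
  have P: "?P \<in> carrier_mat m m" using v by simp
  have H: "mat_adjoint (\<phi>adj ?P) = \<phi>adj ?P" "\<phi>adj ?P \<in> carrier_mat n n"
    using adj_psd[OF psd_mat_outer_prod[OF v]] by (auto simp: psd_mat_iff_qform hermitian_mat_def)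
  have "(\<phi> (mat_adjoint K) *\<^sub>v v) \<bullet>c v = cnj (hs_inner (mat_adjoint K) (\<phi>adj ?P))"
    using hs_inner_outer_prod[OF v v \<phi>K'] hs_inner_commute[OF \<phi>K' P] by (simp add: adj_inner[OF K' P])
  also have "\<dots> = hs_inner K (\<phi>adj ?P)"
    using hs_inner_adjoint[OF K H(2)] hs_inner_commute[OF H(2) K] by (simp add: H(1))
  also have "\<dots> = cnj ((\<phi> K *\<^sub>v v) \<bullet>c v)"
    using hs_inner_outer_prod[OF v v \<phi>K] hs_inner_commute[OF P \<phi>K] by (simp add: adj_inner[OF K P])
  also have "\<dots> = (mat_adjoint (\<phi> K) *\<^sub>v v) \<bullet>c v"
    using cscalar_prod_mat_adjoint[of "mat_adjoint (\<phi> K)" m m v v]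
      cscalar_prod_commute[of "\<phi> K *\<^sub>v v" m v] \<phi>K v
    by simp
  finally show "(\<phi> (mat_adjoint K) *\<^sub>v v) \<bullet>c v = (mat_adjoint (\<phi> K) *\<^sub>v v) \<bullet>c v" .
qed

end

locale schwarz_map =
  fixes n m :: nat and \<phi> \<phi>adj :: "complex mat \<Rightarrow> complex mat"
  assumes lin: "lin_map n m \<phi>" and adj: "hs_adjoint n m \<phi> \<phi>adj"
    and schwarz: "K \<in> carrier_mat n n \<Longrightarrow> mat_le m (mat_adjoint (\<phi> K) * \<phi> K) (\<phi> (mat_adjoint K * K))"

sublocale schwarz_map \<subseteq> positive_map
proof
  fix A assume "psd_mat n A"
  then obtain K where K: "K \<in> carrier_mat n n" and A: "A = mat_adjoint K * K"
    by (rule psd_mat_factorization)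
  have "psd_mat m (\<phi> A - mat_adjoint (\<phi> K) * \<phi> K)" "\<phi> A \<in> carrier_mat m m"
    using schwarz[OF K] by (auto simp: mat_le_def A)
  moreover have "psd_mat m (mat_adjoint (\<phi> K) * \<phi> K)"
    using lin_mapD(1)[OF lin K] by (rule psd_mat_adjoint_mult)
  moreover have "\<phi> A = (\<phi> A - mat_adjoint (\<phi> K) * \<phi> K) + mat_adjoint (\<phi> K) * \<phi> K"
    using lin_mapD(1)[OF lin K] calculation(2) by (intro eq_matI) auto
  ultimately show "psd_mat m (\<phi> A)" by (metis psd_mat_add)
qed (rule lin adj)+

context schwarz_map
begin

lemma schwarz_rmul_inner:
  assumes K: "K \<in> carrier_mat n n" and X: "psd_mat m X"
  shows "hs_inner (\<phi> K) (\<phi> K * X) \<le> hs_inner K (K * \<phi>adj X)"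
proof -
  note Xc = psd_mat_carrier[OF X] and \<phi>K = lin_mapD(1)[OF lin K]
  have \<phi>KK: "psd_mat m (\<phi> (mat_adjoint K * K))" by (rule psd[OF psd_mat_adjoint_mult[OF K]])
  have KK: "mat_adjoint K * K \<in> carrier_mat n n" using K by simp
  have K': "mat_adjoint K \<in> carrier_mat n n" and \<phi>K': "mat_adjoint (\<phi> K) \<in> carrier_mat m m"
    using K \<phi>K by simp_all
  have "hs_inner (\<phi> K) (\<phi> K * X) = mtrace (mat_adjoint (\<phi> K) * \<phi> K * X)"
    using \<phi>K \<phi>K' Xc by (simp add: hs_inner_def assoc_mult_mat[of _ m m _ m _ m])
  also have "\<dots> \<le> mtrace (\<phi> (mat_adjoint K * K) * X)"
    using schwarz[OF K] X by (rule mtrace_mult_mono)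
  also have "\<dots> = hs_inner (\<phi> (mat_adjoint K * K)) X"
    by (simp add: hs_inner_def psd_mat_mat_adjoint[OF \<phi>KK])
  also have "\<dots> = hs_inner (mat_adjoint K * K) (\<phi>adj X)" by (rule adj_inner[OF KK Xc])
  also have "\<dots> = hs_inner K (K * \<phi>adj X)"
    using K K' adj_carrier[OF Xc]
    by (simp add: hs_inner_def mat_adjoint_mult[of _ n n _ n] assoc_mult_mat[of _ n n _ n _ n])
  finally show ?thesis .
qed

lemma schwarz_lmul_inner:
  assumes K: "K \<in> carrier_mat n n" and X: "psd_mat m X"
  shows "hs_inner (\<phi> K) (X * \<phi> K) \<le> hs_inner K (\<phi>adj X * K)"
proof -
  have "mat_adjoint K \<in> carrier_mat n n" using K by simp
  from schwarz_rmul_inner[OF this X] show ?thesis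
    by (simp add: map_mat_adjoint[OF K] hs_inner_mult_left[OF K adj_carrier[OF psd_mat_carrier[OF X]]]
        hs_inner_mult_left[OF lin_mapD(1)[OF lin K] psd_mat_carrier[OF X]])
qed

lemma op_leI_inner:
  assumes S: "lin_map m m S" and T: "lin_map n n T"
    and inner_le: "\<And>K. K \<in> carrier_mat n n \<Longrightarrow> hs_inner (\<phi> K) (S (\<phi> K)) \<le> hs_inner K (T K)"
  shows "op_le n (\<phi>adj \<circ> S \<circ> \<phi>) T"
  unfolding op_le_def op_psd_def
proof
  fix K :: "complex mat" assume K: "K \<in> carrier_mat n n"
  note S\<phi>K = lin_mapD(1)[OF S lin_mapD(1)[OF lin K]]
  show "0 \<le> hs_inner K (T K - (\<phi>adj \<circ> S \<circ> \<phi>) K)"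
    using inner_le[OF K] hs_inner_minus_right[OF K lin_mapD(1)[OF T K] adj_carrier[OF S\<phi>K]]
      adj_inner[OF K S\<phi>K] by simp
qed

lemma schwarz_rmul:
  assumes X: "psd_mat m X"
  shows "op_le n (\<phi>adj \<circ> rmul X \<circ> \<phi>) (rmul (\<phi>adj X))"
  using schwarz_rmul_inner[OF _ X] psd_mat_carrier[OF X]
  by (intro op_leI_inner lin_map_rmul adj_carrier) (simp_all add: rmul_def)

lemma schwarz_lmul:
  assumes X: "psd_mat m X"
  shows "op_le n (\<phi>adj \<circ> lmul X \<circ> \<phi>) (lmul (\<phi>adj X))"
  using schwarz_lmul_inner[OF _ X] psd_mat_carrier[OF X]
  by (intro op_leI_inner lin_map_lmul adj_carrier) (simp_all add: lmul_def)

theorem Jf_conjugation_le: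
  assumes f: "op_monotone f" "\<And>x. x > 0 \<Longrightarrow> f x \<ge> 0" "f 0 = 0"
    and X: "pd_mat m X" and Y: "pd_mat m Y"
  shows "op_le n (\<phi>adj \<circ> Jf m f X Y \<circ> \<phi>) (Jf n f (\<phi>adj X) (\<phi>adj Y))"
proof -
  note psdX = pd_mat_imp_psd_mat[OF X] and psdY = pd_mat_imp_psd_mat[OF Y]
  obtain U \<mu> where U: "unitary_mat m U" and YU: "Y = unitary_diag m U \<mu>" and \<mu>: "\<And>i. i < m \<Longrightarrow> 0 < \<mu> i"
    using pd_mat_spectral[OF Y] by metis
  obtain W \<kappa> where W: "unitary_mat m W" and XW: "X = unitary_diag m W \<kappa>" and \<kappa>: "\<And>i. i < m \<Longrightarrow> 0 < \<kappa> i"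
    using pd_mat_spectral[OF X] by metis
  obtain P c where P: "unitary_mat n P" and YP: "\<phi>adj Y = unitary_diag n P c"
    and c: "\<And>i. i < n \<Longrightarrow> 0 \<le> c i"
    using psd_mat_spectral[OF adj_psd[OF psdY]] by metis
  obtain Q d where Q: "unitary_mat n Q" and XQ: "\<phi>adj X = unitary_diag n Q d"
    and d: "\<And>i. i < n \<Longrightarrow> 0 \<le> d i"
    using psd_mat_spectral[OF adj_psd[OF psdX]] by metis
  note E = hs_onb_unitary_onb[OF P Q] and F = hs_onb_unitary_onb[OF U W]
  obtain V where V: "represents n m (unitary_onb n P Q) (unitary_onb m U W) \<phi> V"
    using lin_map_represents[OF E F lin] by blast
  note le_iff = op_le_conjugation_iff[OF E F adj V]
  have "mat_le (n * n) (mat_adjoint V * rdiag (m * m) (\<lambda>l. \<mu> (l div m)) * V)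
      (rdiag (n * n) (\<lambda>l. c (l div n)))"
    using schwarz_lmul[OF psdY] unfolding YU YP[unfolded YU]
    by (simp add: le_iff[OF diag_op_lmul[OF U W] diag_op_lmul[OF P Q], unfolded length_unitary_onb])
  moreover have "mat_le (n * n) (mat_adjoint V * rdiag (m * m) (\<lambda>l. \<kappa> (l mod m)) * V)
      (rdiag (n * n) (\<lambda>l. d (l mod n)))"
    using schwarz_rmul[OF psdX] unfolding XW XQ[unfolded XW]
    by (simp add: le_iff[OF diag_op_rmul[OF U W] diag_op_rmul[OF P Q], unfolded length_unitary_onb])
  ultimately have "mat_le (n * n)
      (mat_adjoint V * rdiag (m * m) (\<lambda>l. f (\<kappa> (l mod m) / \<mu> (l div m)) * \<mu> (l div m)) * V)
      (rdiag (n * n) (\<lambda>l. f (d (l mod n) / c (l div n)) * c (l div n)))"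
    using representsD(1)[OF V] \<mu> \<kappa> c d div_mod_less_square
    by (intro hansen_perspective_inequality[OF f]) auto
  then show ?thesis
    unfolding YU YP[unfolded YU] XW XQ[unfolded XW] le_iff[OF diag_op_Jf[OF U W] diag_op_Jf[OF P Q]]
      length_unitary_onb .
qed

end

theorem theorem4p4:
  fixes f :: "real \<Rightarrow> real" and n m :: nat
    and \<phi> \<phi>adj :: "complex mat \<Rightarrow> complex mat" and X Y :: "complex mat"
  assumes f_pos: "\<forall>x>0. f x > 0"
    and f_zero: "f 0 = 0"
    and f_opmon: "op_monotone f"
    and phi_lin: "lin_map n m \<phi>"
    and schwarz: "\<forall>K\<in>carrier_mat n n. mat_le m (mat_adjoint (\<phi> K) * \<phi> K) (\<phi> (mat_adjoint K * K))"
    and adj: "hs_adjoint n m \<phi> \<phi>adj"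
    and X: "pd_mat m X" and Y: "pd_mat m Y"
  shows "op_le m (\<phi> \<circ> op_mp n (Jf n f (\<phi>adj X) (\<phi>adj Y)) \<circ> \<phi>adj) (op_inv m (Jf m f X Y)) \<and>
         op_le n (\<phi>adj \<circ> Jf m f X Y \<circ> \<phi>) (Jf n f (\<phi>adj X) (\<phi>adj Y))"
proof -
  interpret schwarz_map n m \<phi> \<phi>adj
    by unfold_locales (use phi_lin schwarz adj in auto)
  have conjugation_le: "op_le n (\<phi>adj \<circ> Jf m f X Y \<circ> \<phi>) (Jf n f (\<phi>adj X) (\<phi>adj Y))"
    using f_pos f_zero f_opmon X Y by (intro Jf_conjugation_le) (auto simp: less_imp_le)
  obtain F g where F: "hs_onb m F" "diag_op m F g (Jf m f X Y)" "\<And>l. l < length F \<Longrightarrow> 0 < g l"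
    using Jf_diag_op_pd[OF X Y] f_pos by metis
  obtain E h where E: "hs_onb n E" "diag_op n E h (Jf n f (\<phi>adj X) (\<phi>adj Y))"
    using Jf_diag_op_psd adj_psd pd_mat_imp_psd_mat X Y by metis
  show ?thesis
    using op_le_conjugation_imp_inverse_conjugation_le[OF E(1) F(1) phi_lin adj F(2) E(2) F(3) conjugation_le]
      conjugation_le by blast
qed

end
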